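(* Let $A(t,s)$ be an $N\times N$ matrix-valued function composed of elements from $\mathcal{D}_0^t(\mathcal{I})$, $\mathcal{I}=[0,1]$, and let $\mathbf{A}=[F^{(k,\ell)}]_{k,\ell=1}^N$ be the related block matrix, with $F^{(k,\ell)}$ the coefficient matrix of $A_{k,\ell}(t,s)$. Moreover, consider the matrix-valued function $C(t,s)=\sum_{k\ge1}A^{\star k}(t,s)$, and let $\mathbf{C}=[H^{(k,\ell)}]_{k,\ell=1}^N$ be the related block matrix, with $H^{(k,\ell)}$ the coefficient matrix of $C_{k,\ell}(t,s)$. Then $$(I+\mathbf{C})(I-\mathbf{A})=I,$$ that is, $(I-\mathbf{A})$ is invertible.
   Context: $\Theta$ is the Heaviside function, $\Theta(t-s)=1$ if $t\ge s$ and $0$ if $t<s$. $\mathcal{A}_\Theta(\mathcal{I})$ is the set of $f(t,s)=\tilde f(t,s)\Theta(t-s)$ with $\tilde f$ analytic in both variables over $\mathcal{I}=[0,1]$, and $\mathcal{A}^t_\Theta(\mathcal{I})$ is the subset of those of the form $f(t,s)=\tilde f(t)\Theta(t-s)$. The $\star$-product is $(f\star g)(t,s)=\int_{\mathcal{I}}f(t,\tau)g(\tau,s)\,d\tau$; for $f,g\in\mathcal{A}_\Theta(\mathcal{I})$ it equals $\Theta(t-s)\int_s^t\tilde f(t,\tau)\tilde g(\tau,s)\,d\tau$, and $1_\star(t,s)=\delta(t-s)$ (Dirac delta) is its identity. $\mathcal{D}_0^t(\mathcal{I})$ is the set of all $\alpha 1_\star+\sum_{i=1}^n g_{i,1}\star\cdots\star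 g_{i,m_i}$ with $\alpha\in\mathbb{C}$ and $g_{i,j}\in\mathcal{A}^t_\Theta(\mathcal{I})$. For matrices, $(A\star B)_{k,\ell}=\sum_{j=1}^N A_{k,j}\star B_{j,\ell}$, and $A^{\star k}$ is the $k$-th $\star$-power. $\{p_k\}_{k\ge0}$ are the orthonormal shifted Legendre polynomials on $[0,1]$. The coefficient matrix of $f\in\mathcal{A}_\Theta(\mathcal{I})$ is the infinite matrix $F=[f_{k,\ell}]_{k,\ell\ge0}$ with $f_{k,\ell}=\int_{\mathcal{I}}\int_{\mathcal{I}}f(\tau,\rho)p_k(\tau)p_\ell(\rho)\,d\rho\,d\tau$; the coefficient matrix of $1_\star$ is the infinite identity matrix, and that of $\alpha 1_\star+f$ is $\alpha$ times the infinite identity matrix plus $F$. Block matrices are $N\times N$ arrays of such infinite matrices; $I$ in the claim is the identity of this size (infinite identity matrices as diagonal blocks, zero blocks elsewhere), and the product of block matrices $[X^{(k,\ell)}]$ and $[Y^{(k,\ell)}]$ has blocks $\sum_{j=1}^N X^{(k,j)}Y^{(j,\ell)}$, each term being a product of infinite matrices with entries given by series.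
   Formalization: It is assumed that the Dirac-delta coefficients of the series defining C converge entrywise; without this C is undefined and the claim can fail (for A = 1_⋆, I − A = 0). Convergence of the remaining function part of C is proved. *)

theory Defs
  imports "HOL-Analysis.Analysis"
begin

section \<open>Kernels on the unit square and their \<open>\<star>\<close>-product\<close>

text \<open>A function of \<open>(t, s)\<close> on \<open>[0,1] \<times> [0,1]\<close> is represented by a total function;
  only its values on the unit square are ever used.\<close>

type_synonym kernel = "real \<Rightarrow> real \<Rightarrow> complex"

abbreviation unit_ivl :: "real set" where
  "unit_ivl \<equiv> {0..1}"

definition heaviside :: "real \<Rightarrow> complex" where
  "heaviside x = (if x \<ge> 0 then 1 else 0)"

text \<open>A complex-valued function is analytic over the compact interval iff it is the restriction
  of a holomorphic function on a complex neighbourhood of that interval.\<close>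

definition analytic_on_unit_ivl :: "(real \<Rightarrow> complex) \<Rightarrow> bool" where
  "analytic_on_unit_ivl f \<longleftrightarrow>
     (\<exists>F. F analytic_on (complex_of_real ` unit_ivl) \<and>
          (\<forall>t\<in>unit_ivl. f t = F (complex_of_real t)))"

definition A_Theta_t :: "kernel set" where
  "A_Theta_t = {f. \<exists>ft. analytic_on_unit_ivl ft \<and>
     (\<forall>t\<in>unit_ivl. \<forall>s\<in>unit_ivl. f t s = ft t * heaviside (t - s))}"

definition kernel_star :: "kernel \<Rightarrow> kernel \<Rightarrow> kernel" where
  "kernel_star f g = (\<lambda>t s. LBINT \<tau>:unit_ivl. f t \<tau> * g \<tau> s)"

text \<open>\<open>g\<^sub>1 \<star> \<dots> \<star> g\<^sub>m\<close> for \<open>m \<ge> 1\<close>; the empty product is left unspecified.\<close>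

fun kernel_star_list :: "kernel list \<Rightarrow> kernel" where
  "kernel_star_list [g] = g"
| "kernel_star_list (g # h # gs) = kernel_star g (kernel_star_list (h # gs))"

section \<open>Adjoining the Dirac delta\<close>

text \<open>\<open>StarDist \<alpha> f\<close> stands for the distribution \<open>\<alpha> \<delta>(t - s) + f(t, s)\<close>.\<close>

datatype star_dist = StarDist (delta_coeff: complex) (kernel_part: kernel)

instantiation star_dist :: comm_monoid_add
begin

definition zero_star_dist :: star_dist where
  "0 = StarDist 0 (\<lambda>t s. 0)"

definition plus_star_dist :: "star_dist \<Rightarrow> star_dist \<Rightarrow> star_dist" where
  "X + Y = StarDist (delta_coeff X + delta_coeff Y)
                    (\<lambda>t s. kernel_part X t s + kernel_part Y t s)"

instance
  by standard (auto simp: zero_star_dist_def plus_star_dist_def algebra_simps)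

end

definition star_one :: star_dist where
  "star_one = StarDist 1 (\<lambda>t s. 0)"

text \<open>The bilinear extension of \<open>kernel_star\<close> for which \<open>star_one\<close> is the identity.\<close>

definition star :: "star_dist \<Rightarrow> star_dist \<Rightarrow> star_dist" (infixl "\<star>" 70) where
  "X \<star> Y = StarDist (delta_coeff X * delta_coeff Y)
     (\<lambda>t s. delta_coeff X * kernel_part Y t s + delta_coeff Y * kernel_part X t s
            + kernel_star (kernel_part X) (kernel_part Y) t s)"

definition D0_t :: "star_dist set" where
  "D0_t = {StarDist \<alpha> f | \<alpha> f. \<exists>gs :: kernel list list.
     (\<forall>g\<in>set gs. g \<noteq> [] \<and> set g \<subseteq> A_Theta_t) \<and>
     (\<forall>t\<in>unit_ivl. \<forall>s\<in>unit_ivl. f t s = (\<Sum>g\<leftarrow>gs. kernel_star_list g t s))}"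

section \<open>Matrices of distributions\<close>

definition mat_star :: "star_dist^'n^'n \<Rightarrow> star_dist^'n^'n \<Rightarrow> star_dist^'n^'n" where
  "mat_star A B = (\<chi> k l. \<Sum>j\<in>UNIV. A $ k $ j \<star> B $ j $ l)"

primrec mat_star_power :: "star_dist^'n^'n \<Rightarrow> nat \<Rightarrow> star_dist^'n^'n" where
  "mat_star_power A 0 = (\<chi> k l. if k = l then star_one else 0)"
| "mat_star_power A (Suc m) = mat_star A (mat_star_power A m)"

text \<open>\<open>C\<close> is the sum of \<open>A\<^sup>\<star>\<^sup>1 + A\<^sup>\<star>\<^sup>2 + \<dots>\<close>: the delta coefficients converge, and the kernel
  parts converge pointwise on the unit square.\<close>

definition star_series_sums :: "star_dist^'n^'n \<Rightarrow> star_dist^'n^'n \<Rightarrow> bool" where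
  "star_series_sums A C \<longleftrightarrow> (\<forall>k l.
     (\<lambda>m. delta_coeff (mat_star_power A (Suc m) $ k $ l)) sums delta_coeff (C $ k $ l) \<and>
     (\<forall>t\<in>unit_ivl. \<forall>s\<in>unit_ivl.
       (\<lambda>m. kernel_part (mat_star_power A (Suc m) $ k $ l) t s)
         sums kernel_part (C $ k $ l) t s))"

definition star_series :: "star_dist^'n^'n \<Rightarrow> star_dist^'n^'n" where
  "star_series A = (\<chi> k l. StarDist
     (\<Sum>m. delta_coeff (mat_star_power A (Suc m) $ k $ l))
     (\<lambda>t s. \<Sum>m. kernel_part (mat_star_power A (Suc m) $ k $ l) t s))"

section \<open>Legendre coefficient matrices\<close>

text \<open>Rodrigues' formula, normalised in \<open>L\<^sup>2[0,1]\<close>: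
  \<open>p\<^sub>k(x) = sqrt (2k+1) P\<^sub>k(2x-1)\<close> with
  \<open>P\<^sub>k(2x-1) = (1/k!) (d/dx)\<^sup>k (x\<^sup>2 - x)\<^sup>k\<close>.\<close>

definition shifted_legendre :: "nat \<Rightarrow> real poly" where
  "shifted_legendre k =
     smult (sqrt (2 * real k + 1) / fact k) ((pderiv ^^ k) ([:0, -1, 1:] ^ k))"

type_synonym inf_matrix = "nat \<Rightarrow> nat \<Rightarrow> complex"

definition inf_matrix_one :: inf_matrix where
  "inf_matrix_one = (\<lambda>i j. if i = j then 1 else 0)"

definition kernel_coeff_matrix :: "kernel \<Rightarrow> inf_matrix" where
  "kernel_coeff_matrix f = (\<lambda>i j.
     LBINT \<tau>:unit_ivl. (LBINT \<rho>:unit_ivl.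
       f \<tau> \<rho> * complex_of_real (poly (shifted_legendre i) \<tau>)
             * complex_of_real (poly (shifted_legendre j) \<rho>)))"

definition coeff_matrix :: "star_dist \<Rightarrow> inf_matrix" where
  "coeff_matrix X = (\<lambda>i j.
     delta_coeff X * inf_matrix_one i j + kernel_coeff_matrix (kernel_part X) i j)"

section \<open>Block matrices with infinite blocks\<close>

definition block_matrix :: "star_dist^'n^'n \<Rightarrow> inf_matrix^'n^'n" where
  "block_matrix A = (\<chi> k l. coeff_matrix (A $ k $ l))"

definition block_one :: "inf_matrix^'n^'n" where
  "block_one = (\<chi> k l. if k = l then inf_matrix_one else (\<lambda>i j. 0))"

definition block_add :: "inf_matrix^'n^'n \<Rightarrow> inf_matrix^'n^'n \<Rightarrow> inf_matrix^'n^'n" where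
  "block_add X Y = (\<chi> k l. (\<lambda>i j. (X $ k $ l) i j + (Y $ k $ l) i j))"

definition block_diff :: "inf_matrix^'n^'n \<Rightarrow> inf_matrix^'n^'n \<Rightarrow> inf_matrix^'n^'n" where
  "block_diff X Y = (\<chi> k l. (\<lambda>i j. (X $ k $ l) i j - (Y $ k $ l) i j))"

definition block_mult :: "inf_matrix^'n^'n \<Rightarrow> inf_matrix^'n^'n \<Rightarrow> inf_matrix^'n^'n" where
  "block_mult X Y =
     (\<chi> k l. (\<lambda>i j. \<Sum>q\<in>UNIV. \<Sum>m. (X $ k $ q) i m * (Y $ q $ l) m j))"

text \<open>The product exists, i.e. every entry series of every product of blocks converges, and it
  equals \<open>Z\<close>.\<close>

definition is_block_product ::
    "inf_matrix^'n^'n \<Rightarrow> inf_matrix^'n^'n \<Rightarrow> inf_matrix^'n^'n \<Rightarrow> bool" where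
  "is_block_product X Y Z \<longleftrightarrow>
     (\<forall>k q l i j. summable (\<lambda>m. (X $ k $ q) i m * (Y $ q $ l) m j)) \<and>
     block_mult X Y = Z"

definition block_invertible :: "inf_matrix^'n^'n \<Rightarrow> bool" where
  "block_invertible X \<longleftrightarrow>
     (\<exists>Y. is_block_product Y X block_one \<and> is_block_product X Y block_one)"

end

theory Submission
  imports Defs
begin

text \<open>
The claim is the image, under a multiplicative map, of the identity
\<open>(1 + C) \<star> (1 - A) = 1\<close> for the Neumann series.

Multiplicativity: if \<open>f\<close> and \<open>g\<close> vanish for \<open>t < s\<close> and are continuous on the triangle \<open>s \<le> t\<close>
(\<^emph>\<open>Volterra kernels\<close>), then an entry of the coefficient matrix of \<open>f \<star> g\<close> is the integral of \<open>\<phi> \<psi>\<close>,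
where \<open>\<phi>\<close> arises from integrating \<open>f\<close> against \<open>p\<^sub>i\<close> in its first variable and \<open>\<psi>\<close> from integrating
\<open>g\<close> against \<open>p\<^sub>j\<close> in its second one. The Legendre coefficients of these continuous functions are the
entries of the two coefficient matrices, so Parseval's identity says precisely that the entry is the
convergent series of the matrix product (\<open>kernel_coeff_matrix_star\<close>). Parseval's identity
(\<open>parseval_shifted_legendre\<close>) rests on the orthonormality given by Rodrigues' formula and on the
Weierstrass approximation theorem.

Neumann series: let \<open>a\<close> be the matrix of Dirac coefficients of \<open>A\<close>. Convergence of the series of its
powers makes these powers decay geometrically. The kernel part of \<open>A\<close> does not spoil this, because a
Volterra operator has arbitrarily small norm with respect to a suitable exponential weight
(\<open>norm_kernel_star_le\<close>). Hence the kernels of the powers of \<open>A\<close> decay geometrically as well, uniformly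
on the unit square (\<open>kernel_mat_power_geometric_decay\<close>). The series therefore converges uniformly, its
sum is again a matrix of Volterra kernels, and termwise multiplication by \<open>A\<close> on either side is
legitimate; this yields \<open>A \<star> (1 + C) = C = (1 + C) \<star> A\<close> and thereby both one-sided inverses
(\<open>mat_star_inverse\<close>).
\<close>

section \<open>Orthonormality of the shifted Legendre polynomials\<close>

lemma poly_integrable_unit_ivl: "poly (p :: real poly) integrable_on {0..1}"
  by (intro integrable_continuous_real continuous_intros)

lemma poly_0_fun: "poly 0 = (\<lambda>x. 0)"
  by auto

lemma poly_smult_fun: "poly (smult c p) = (\<lambda>x. c * poly p x)"
  by auto

lemma poly_mult_fun: "poly (p * q) = (\<lambda>x. poly p x * poly q x)"
  by auto

lemma integral_poly_pderiv:
  fixes p :: "real poly"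
  shows "integral {0..1} (poly (pderiv p)) = poly p 1 - poly p 0"
proof -
  have "(poly (pderiv p) has_integral (poly p 1 - poly p 0)) {0..1}"
    by (rule fundamental_theorem_of_calculus)
       (auto intro!: has_field_derivative_at_within poly_DERIV
             simp flip: has_real_derivative_iff_has_vector_derivative)
  thus ?thesis by (rule integral_unique)
qed

lemma integral_poly_by_parts:
  fixes p q :: "real poly"
  assumes "poly p 0 = 0" "poly p 1 = 0"
  shows "integral {0..1} (poly (pderiv p * q)) = - integral {0..1} (poly (p * pderiv q))"
proof -
  have "0 = integral {0..1} (poly (pderiv (p * q)))"
    using assms by (simp add: integral_poly_pderiv)
  also have "poly (pderiv (p * q)) = (\<lambda>x. poly (pderiv p * q) x + poly (p * pderiv q) x)"
    by (auto simp: pderiv_mult)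
  also have "integral {0..1} \<dots> =
      integral {0..1} (poly (pderiv p * q)) + integral {0..1} (poly (p * pderiv q))"
    by (rule integral_add) (rule poly_integrable_unit_ivl)+
  finally show ?thesis by simp
qed

text \<open>Moving all derivatives of Rodrigues' formula onto the other factor: the boundary terms are
assumed to vanish at every stage, so only the sign survives.\<close>

lemma integral_poly_by_parts_iterated:
  fixes p q :: "real poly"
  assumes "\<And>l. l < k \<Longrightarrow> poly ((pderiv ^^ l) p) 0 = 0 \<and> poly ((pderiv ^^ l) p) 1 = 0"
  shows "integral {0..1} (poly ((pderiv ^^ k) p * q)) =
         (-1) ^ k * integral {0..1} (poly (p * (pderiv ^^ k) q))"
  using assms
proof (induction k arbitrary: q)
  case (Suc k)
  have "integral {0..1} (poly ((pderiv ^^ Suc k) p * q)) =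
        - integral {0..1} (poly ((pderiv ^^ k) p * pderiv q))"
    using Suc.prems[of k] by (simp add: integral_poly_by_parts)
  also have "\<dots> = - ((-1) ^ k * integral {0..1} (poly (p * (pderiv ^^ k) (pderiv q))))"
    by (subst Suc.IH) (use Suc.prems in auto)
  finally show ?case by (simp add: funpow_swap1 del: poly_mult)
qed simp

lemma power_dvd_pderiv:
  fixes w f :: "real poly"
  assumes "w ^ Suc m dvd f"
  shows "w ^ m dvd pderiv f"
proof -
  obtain g where f: "f = w ^ Suc m * g" using assms by blast
  have "pderiv f = w ^ m * (smult (of_nat (Suc m)) (pderiv w * g) + w * pderiv g)"
    unfolding f pderiv_mult pderiv_power_Suc by (simp add: algebra_simps)
  thus ?thesis by simp
qed

lemma power_dvd_higher_pderiv:
  fixes w :: "real poly"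
  assumes "l \<le> k"
  shows "w ^ (k - l) dvd (pderiv ^^ l) (w ^ k)"
  using assms
proof (induction l)
  case (Suc l)
  hence "w ^ Suc (k - Suc l) dvd (pderiv ^^ l) (w ^ k)"
    by (simp add: Suc_diff_Suc del: power_Suc)
  thus ?case using power_dvd_pderiv by simp
qed simp

abbreviation rodrigues_base :: "real poly" where
  "rodrigues_base \<equiv> [:0, -1, 1:]"

text \<open>Each derivative costs one factor of \<open>x\<^sup>2 - x\<close>, so as long as fewer than \<open>k\<close> are taken a factor
remains, and it vanishes at both endpoints.\<close>

lemma higher_pderiv_rodrigues_endpoints:
  assumes "l < k"
  shows "poly ((pderiv ^^ l) (rodrigues_base ^ k)) 0 = 0 \<and>
         poly ((pderiv ^^ l) (rodrigues_base ^ k)) 1 = 0"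
proof -
  have "rodrigues_base dvd rodrigues_base ^ (k - l)"
    using assms by (intro dvd_power) auto
  hence "rodrigues_base dvd (pderiv ^^ l) (rodrigues_base ^ k)"
    using power_dvd_higher_pderiv[of l k rodrigues_base] assms dvd_trans by auto
  then obtain g where "(pderiv ^^ l) (rodrigues_base ^ k) = rodrigues_base * g" by blast
  thus ?thesis by simp
qed

lemma integral_rodrigues_by_parts:
  "integral {0..1} (poly ((pderiv ^^ k) (rodrigues_base ^ k) * q)) =
   (-1) ^ k * integral {0..1} (poly (rodrigues_base ^ k * (pderiv ^^ k) q))"
  by (rule integral_poly_by_parts_iterated) (rule higher_pderiv_rodrigues_endpoints)

lemma degree_rodrigues_power: "degree (rodrigues_base ^ k) = 2 * k"
  by (simp add: degree_power_eq)

lemma lead_coeff_rodrigues_power: "lead_coeff (rodrigues_base ^ k) = 1"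
  by (simp add: lead_coeff_power)

lemma degree_shifted_legendre: "degree (shifted_legendre k) = k"
  unfolding shifted_legendre_def
  by (simp add: degree_higher_pderiv degree_rodrigues_power real_sqrt_eq_zero_cancel_iff)

lemma higher_pderiv_eq_0:
  fixes p :: "real poly"
  assumes "degree p < k"
  shows "(pderiv ^^ k) p = 0"
  using assms by (intro poly_eqI) (simp add: coeff_higher_pderiv coeff_eq_0)

lemma higher_pderiv_degree:
  fixes p :: "real poly"
  shows "(pderiv ^^ degree p) p = [:fact (degree p) * lead_coeff p:]"
proof (rule poly_eqI)
  fix n
  show "coeff ((pderiv ^^ degree p) p) n = coeff [:fact (degree p) * lead_coeff p:] n"
  proof (cases n)
    case 0
    thus ?thesis by (simp add: coeff_higher_pderiv pochhammer_fact)
  next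
    case (Suc m)
    thus ?thesis by (simp add: coeff_higher_pderiv coeff_eq_0)
  qed
qed

text \<open>Up to the sign this is the Beta integral \<open>B(k+1, k+1)\<close>; it fixes the normalisation of the
polynomials.\<close>

lemma integral_rodrigues_power:
  "integral {0..1} (poly (rodrigues_base ^ k)) = (-1) ^ k * (fact k)\<^sup>2 / fact (2 * k + 1)"
proof -
  have "((\<lambda>t. t powr (real (k + 1) - 1) * (1 - t) powr (real (k + 1) - 1))
          has_integral Beta (real (k + 1)) (real (k + 1))) {0..1}"
    by (rule has_integral_Beta_real) auto
  \<comment> \<open>At the endpoints \<open>powr\<close> and \<open>^\<close> disagree for \<open>k = 0\<close>, whence the negligible set.\<close>
  hence "((\<lambda>t. t ^ k * (1 - t) ^ k) has_integral Beta (real (k + 1)) (real (k + 1))) {0..1}"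
    by (rule has_integral_spike[OF negligible_finite[of "{0, 1}"], rotated 2])
       (auto simp: powr_realpow)
  also have "Beta (real (k + 1)) (real (k + 1)) = (fact k)\<^sup>2 / fact (2 * k + 1)"
  proof -
    have "Gamma (real (k + 1)) = fact k"
      using Gamma_fact[of k, where 'a = real] by (simp add: add.commute)
    moreover have "Gamma (real (k + 1) + real (k + 1)) = fact (2 * k + 1)"
      using Gamma_fact[of "2 * k + 1", where 'a = real] by (simp add: algebra_simps)
    ultimately show ?thesis by (simp add: Beta_def power2_eq_square)
  qed
  finally have B: "((\<lambda>t. t ^ k * (1 - t) ^ k) has_integral (fact k)\<^sup>2 / fact (2 * k + 1)) {0..1::real}" .
  have "((\<lambda>t. (-1) ^ k * (t ^ k * (1 - t) ^ k)) has_integral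
      (-1) ^ k * ((fact k)\<^sup>2 / fact (2 * k + 1))) {0..1::real}"
    using has_integral_mult_right[OF B, of "(-1) ^ k"] by simp
  moreover have "(\<lambda>t. (-1) ^ k * (t ^ k * (1 - t) ^ k)) = poly (rodrigues_base ^ k)"
  proof
    fix t :: real
    have "(-1) ^ k * (t ^ k * (1 - t) ^ k) = ((-1) * (t * (1 - t))) ^ k"
      by (simp only: power_mult_distrib)
    also have "(-1) * (t * (1 - t)) = poly rodrigues_base t"
      by (simp add: algebra_simps)
    finally show "(-1) ^ k * (t ^ k * (1 - t) ^ k) = poly (rodrigues_base ^ k) t" by simp
  qed
  ultimately show ?thesis by (simp add: integral_unique)
qed

lemma integral_shifted_legendre_lower_degree:
  assumes "degree q < k"
  shows "integral {0..1} (poly (shifted_legendre k * q)) = 0"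
proof -
  have "integral {0..1} (poly ((pderiv ^^ k) (rodrigues_base ^ k) * q)) = 0"
    unfolding integral_rodrigues_by_parts higher_pderiv_eq_0[OF assms] by (simp add: poly_0_fun)
  thus ?thesis by (simp add: shifted_legendre_def poly_smult_fun del: poly_mult)
qed

text \<open>Integrating by parts \<open>k\<close> times leaves the \<open>2k\<close>-th derivative of the monic polynomial
\<open>(x\<^sup>2 - x)\<^sup>k\<close> of degree \<open>2k\<close>, which is the constant \<open>(2k)!\<close>, times a Beta integral.\<close>

lemma integral_shifted_legendre_square:
  "integral {0..1} (poly (shifted_legendre k * shifted_legendre k)) = 1"
proof -
  define c where "c = sqrt (2 * real k + 1) / fact k"
  define w where "w = rodrigues_base ^ k"
  have "(pderiv ^^ k) ((pderiv ^^ k) w) = (pderiv ^^ degree w) w"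
    by (simp add: w_def degree_rodrigues_power mult_2 funpow_add)
  also have "\<dots> = [:fact (2 * k):]"
    using higher_pderiv_degree[of w] lead_coeff_rodrigues_power[of k]
    by (simp add: w_def degree_rodrigues_power)
  finally have D: "(pderiv ^^ k) ((pderiv ^^ k) w) = [:fact (2 * k):]" .
  have "integral {0..1} (poly ((pderiv ^^ k) w * (pderiv ^^ k) w)) =
      (-1) ^ k * integral {0..1} (poly (w * [:fact (2 * k):]))"
    unfolding D[symmetric] w_def by (rule integral_rodrigues_by_parts)
  also have "\<dots> = (-1) ^ k * (fact (2 * k) * ((-1) ^ k * (fact k)\<^sup>2 / fact (2 * k + 1)))"
    unfolding integral_rodrigues_power[symmetric] w_def by (simp add: poly_smult_fun del: poly_power)
  also have "\<dots> = fact (2 * k) * (fact k)\<^sup>2 / fact (2 * k + 1)"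
    by (simp add: flip: power_mult_distrib)
  also have "\<dots> = (fact k)\<^sup>2 / (2 * real k + 1)"
    by (simp add: divide_simps)
  finally have I: "integral {0..1} (poly ((pderiv ^^ k) w * (pderiv ^^ k) w)) =
      (fact k)\<^sup>2 / (2 * real k + 1)" .
  have "integral {0..1} (poly (shifted_legendre k * shifted_legendre k)) =
      c\<^sup>2 * integral {0..1} (poly ((pderiv ^^ k) w * (pderiv ^^ k) w))"
  proof -
    have "shifted_legendre k * shifted_legendre k =
        smult (c\<^sup>2) ((pderiv ^^ k) w * (pderiv ^^ k) w)"
      by (simp add: shifted_legendre_def c_def w_def power2_eq_square)
    thus ?thesis by (simp only: poly_smult_fun integral_mult_right)
  qed
  also have "\<dots> = 1"
    unfolding I by (simp add: c_def power_divide)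
  finally show ?thesis .
qed

theorem shifted_legendre_orthonormal:
  "integral {0..1} (\<lambda>x. poly (shifted_legendre i) x * poly (shifted_legendre j) x) =
   (if i = j then 1 else 0)"
proof -
  have "integral {0..1} (poly (shifted_legendre i * shifted_legendre j)) = (if i = j then 1 else 0)"
  proof (cases i j rule: linorder_cases)
    case less
    have "integral {0..1} (poly (shifted_legendre j * shifted_legendre i)) = 0"
      by (rule integral_shifted_legendre_lower_degree) (simp add: degree_shifted_legendre less)
    with less show ?thesis by (simp add: mult.commute del: poly_mult)
  next
    case equal
    thus ?thesis using integral_shifted_legendre_square[of i] by (simp del: poly_mult)
  next
    case greater
    thus ?thesis
      using integral_shifted_legendre_lower_degree[of "shifted_legendre j" i]
      by (simp add: degree_shifted_legendre del: poly_mult)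
  qed
  thus ?thesis by (simp only: poly_mult_fun)
qed

text \<open>Since \<open>shifted_legendre n\<close> has degree exactly \<open>n\<close>, subtracting a multiple of it lowers the degree.\<close>

lemma poly_in_span_shifted_legendre:
  fixes q :: "real poly"
  assumes "degree q < n"
  shows "\<exists>c. q = (\<Sum>m<n. smult (c m) (shifted_legendre m))"
  using assms
proof (induction n arbitrary: q)
  case (Suc n)
  define L where "L = shifted_legendre n"
  have Ldeg: "degree L = n" and Lnz: "coeff L n \<noteq> 0"
  proof -
    show d: "degree L = n" by (simp add: L_def degree_shifted_legendre)
    have "L \<noteq> 0" using integral_shifted_legendre_square[of n] by (auto simp: L_def poly_0_fun)
    thus "coeff L n \<noteq> 0" using d by (metis leading_coeff_0_iff)
  qed
  define a where "a = coeff q n / coeff L n"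
  define r where "r = q - smult a L"
  have "coeff r m = 0" if "m \<ge> n" for m
  proof (cases "m = n")
    case True
    thus ?thesis using Lnz by (simp add: r_def a_def)
  next
    case False
    thus ?thesis using that Suc.prems Ldeg by (simp add: r_def coeff_eq_0)
  qed
  hence r: "n = 0 \<longrightarrow> r = 0" "n > 0 \<longrightarrow> degree r < n"
    by (auto simp: poly_eq_iff intro!: degree_lessI)
  have "\<exists>c. r = (\<Sum>m<n. smult (c m) (shifted_legendre m))"
    using r Suc.IH[of r] by (cases "n = 0") auto
  then obtain c where c: "r = (\<Sum>m<n. smult (c m) (shifted_legendre m))" by blast
  have "q = r + smult a L" by (simp add: r_def)
  also have "\<dots> = (\<Sum>m<Suc n. smult ((c(n := a)) m) (shifted_legendre m))"
    unfolding c by (simp add: L_def)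
  finally show ?case by blast
qed simp

section \<open>Parseval's identity\<close>

abbreviation legendre_coeff :: "(real \<Rightarrow> real) \<Rightarrow> nat \<Rightarrow> real" where
  "legendre_coeff \<phi> m \<equiv> integral {0..1} (\<lambda>x. \<phi> x * poly (shifted_legendre m) x)"

text \<open>The expansion behind best approximation: the squared distance from \<open>\<phi>\<close> to a combination of the first
\<open>n\<close> polynomials is smallest for the Legendre coefficients. It yields Bessel's inequality (take \<open>c\<close>
to be these coefficients) and the lower bound on the partial sums that completeness needs.\<close>

lemma integral_square_minus_legendre_sum:
  fixes \<phi> :: "real \<Rightarrow> real"
  assumes "continuous_on {0..1} \<phi>"
  shows "integral {0..1} (\<lambda>x. (\<phi> x - (\<Sum>m<n. c m * poly (shifted_legendre m) x))\<^sup>2) =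
    integral {0..1} (\<lambda>x. (\<phi> x)\<^sup>2) - (\<Sum>m<n. (legendre_coeff \<phi> m)\<^sup>2)
      + (\<Sum>m<n. (legendre_coeff \<phi> m - c m)\<^sup>2)"
proof (induction n)
  case (Suc n)
  define p where "p = (\<lambda>m. poly (shifted_legendre m))"
  define r where "r = (\<lambda>x. \<phi> x - (\<Sum>m<n. c m * p m x))"
  have cp: "continuous_on {0..1} (p m)" for m
    unfolding p_def by (intro continuous_intros)
  have cr: "continuous_on {0..1} r"
    unfolding r_def using assms cp by (intro continuous_intros)
  note int = integrable_continuous_real
  have "integral {0..1} (\<lambda>x. r x * p n x) =
      integral {0..1} (\<lambda>x. \<phi> x * p n x - (\<Sum>m<n. c m * (p m x * p n x)))"
    by (simp add: r_def algebra_simps sum_distrib_left)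
  also have "\<dots> = integral {0..1} (\<lambda>x. \<phi> x * p n x)
      - (\<Sum>m<n. c m * integral {0..1} (\<lambda>x. p m x * p n x))"
    using assms cp
    by (subst integral_diff) (auto intro!: int continuous_intros simp: integral_sum integrable_continuous_real continuous_intros)
  also have "\<dots> = legendre_coeff \<phi> n"
    by (simp add: p_def shifted_legendre_orthonormal)
  finally have rp: "integral {0..1} (\<lambda>x. r x * p n x) = legendre_coeff \<phi> n" .
  have "integral {0..1} (\<lambda>x. (\<phi> x - (\<Sum>m<Suc n. c m * p m x))\<^sup>2) =
      integral {0..1} (\<lambda>x. (r x)\<^sup>2 - 2 * c n * (r x * p n x) + (c n)\<^sup>2 * (p n x * p n x))"
    by (rule integral_cong) (simp add: r_def power2_eq_square algebra_simps)
  also have "\<dots> = integral {0..1} (\<lambda>x. (r x)\<^sup>2) - 2 * c n * integral {0..1} (\<lambda>x. r x * p n x)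
      + (c n)\<^sup>2 * integral {0..1} (\<lambda>x. p n x * p n x)"
  proof -
    have i: "(\<lambda>x. (r x)\<^sup>2) integrable_on {0..1}" "(\<lambda>x. 2 * c n * (r x * p n x)) integrable_on {0..1}"
        "(\<lambda>x. (c n)\<^sup>2 * (p n x * p n x)) integrable_on {0..1}"
      using cr cp by (auto intro!: int continuous_intros)
    show ?thesis
      using integral_add[OF integrable_diff[OF i(1,2)] i(3)] integral_diff[OF i(1,2)] by simp
  qed
  also have "integral {0..1} (\<lambda>x. p n x * p n x) = 1"
    by (simp add: p_def shifted_legendre_orthonormal)
  finally show ?case
    using Suc rp by (simp add: p_def r_def power2_eq_square algebra_simps)
qed simp

text \<open>Completeness comes from the Weierstrass theorem: a polynomial uniformly close to \<open>\<phi>\<close> lies in the span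
of the first \<open>n\<close> Legendre polynomials, and the Legendre partial sum is at least as close to \<open>\<phi>\<close> in
the quadratic mean.\<close>

theorem parseval_shifted_legendre_square:
  fixes \<phi> :: "real \<Rightarrow> real"
  assumes cont: "continuous_on {0..1} \<phi>"
  shows "(\<lambda>m. (legendre_coeff \<phi> m)\<^sup>2) sums integral {0..1} (\<lambda>x. (\<phi> x)\<^sup>2)"
  unfolding sums_def
proof (rule LIMSEQ_I)
  fix e :: real
  assume "e > 0"
  define \<epsilon> where "\<epsilon> = sqrt (e / 2)"
  have \<epsilon>: "\<epsilon> > 0" "\<epsilon>\<^sup>2 = e / 2" using \<open>e > 0\<close> by (auto simp: \<epsilon>_def)
  obtain g where g: "real_polynomial_function g" "\<And>x. x \<in> {0..1} \<Longrightarrow> \<bar>\<phi> x - g x\<bar> < \<epsilon>"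
    using Stone_Weierstrass_real_polynomial_function[OF compact_Icc cont \<epsilon>(1)] by blast
  obtain a N where aN: "g = (\<lambda>x. \<Sum>i\<le>N. a i * x ^ i)"
    using g(1) real_polynomial_function_iff_sum by blast
  define q where "q = (\<Sum>i\<le>N. monom (a i) i)"
  have gq: "g x = poly q x" for x
    by (simp add: q_def aN poly_sum poly_monom)
  have degq: "degree q \<le> N"
    unfolding q_def by (intro degree_sum_le) (auto intro: order_trans[OF degree_monom_le])
  have "norm ((\<Sum>m<n. (legendre_coeff \<phi> m)\<^sup>2) - integral {0..1} (\<lambda>x. (\<phi> x)\<^sup>2)) < e"
    if n: "n \<ge> Suc N" for n
  proof -
    obtain c where c: "q = (\<Sum>m<n. smult (c m) (shifted_legendre m))"
      using poly_in_span_shifted_legendre[of q n] degq n by auto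
    have "integral {0..1} (\<lambda>x. (\<phi> x - g x)\<^sup>2) \<le> integral {0..1} (\<lambda>x::real. \<epsilon>\<^sup>2)"
    proof (rule integral_le)
      show "(\<lambda>x. (\<phi> x - g x)\<^sup>2) integrable_on {0..1}"
        unfolding gq by (intro integrable_continuous_real continuous_intros cont)
      show "(\<phi> x - g x)\<^sup>2 \<le> \<epsilon>\<^sup>2" if "x \<in> {0..1}" for x
        using power_mono[of "\<bar>\<phi> x - g x\<bar>" \<epsilon> 2] g(2)[OF that] by simp
    qed auto
    moreover have "g = (\<lambda>x. \<Sum>m<n. c m * poly (shifted_legendre m) x)"
    proof
      show "g x = (\<Sum>m<n. c m * poly (shifted_legendre m) x)" for x
        unfolding gq by (subst c) (simp add: poly_sum)
    qed
    ultimately have "integral {0..1} (\<lambda>x. (\<phi> x)\<^sup>2) - (\<Sum>m<n. (legendre_coeff \<phi> m)\<^sup>2)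
        + (\<Sum>m<n. (legendre_coeff \<phi> m - c m)\<^sup>2) \<le> \<epsilon>\<^sup>2"
      using integral_square_minus_legendre_sum[OF cont, where n = n and c = c] by simp
    moreover have "(\<Sum>m<n. (legendre_coeff \<phi> m - c m)\<^sup>2) \<ge> 0"
      by (intro sum_nonneg) auto
    moreover have "integral {0..1} (\<lambda>x. (\<phi> x)\<^sup>2) - (\<Sum>m<n. (legendre_coeff \<phi> m)\<^sup>2) \<ge> 0"
    proof -
      have "integral {0..1}
          (\<lambda>x. (\<phi> x - (\<Sum>m<n. legendre_coeff \<phi> m * poly (shifted_legendre m) x))\<^sup>2) \<ge> 0"
        by (intro integral_nonneg integrable_continuous_real continuous_intros cont) auto
      thus ?thesis
        using integral_square_minus_legendre_sum[OF cont, where n = n and c = "legendre_coeff \<phi>"] by simp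
    qed
    ultimately show ?thesis using \<epsilon> \<open>e > 0\<close> by (simp add: abs_if)
  qed
  thus "\<exists>no. \<forall>n\<ge>no. norm ((\<Sum>m<n. (legendre_coeff \<phi> m)\<^sup>2) - integral {0..1} (\<lambda>x. (\<phi> x)\<^sup>2)) < e"
    by blast
qed

text \<open>By polarisation of the quadratic identity.\<close>

lemma parseval_shifted_legendre_real:
  fixes \<phi> \<psi> :: "real \<Rightarrow> real"
  assumes "continuous_on {0..1} \<phi>" "continuous_on {0..1} \<psi>"
  shows "(\<lambda>m. legendre_coeff \<phi> m * legendre_coeff \<psi> m) sums
         integral {0..1} (\<lambda>x. \<phi> x * \<psi> x)"
proof -
  note int = integrable_continuous_real
  let ?I = "\<lambda>f. integral {0..1} f"
  have add: "legendre_coeff (\<lambda>x. \<phi> x + \<psi> x) m = legendre_coeff \<phi> m + legendre_coeff \<psi> m"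
    and diff: "legendre_coeff (\<lambda>x. \<phi> x - \<psi> x) m = legendre_coeff \<phi> m - legendre_coeff \<psi> m" for m
    using assms unfolding distrib_right left_diff_distrib
    by (auto intro!: integral_add integral_diff int continuous_intros)
  have "(\<lambda>m. (legendre_coeff (\<lambda>x. \<phi> x + \<psi> x) m)\<^sup>2) sums ?I (\<lambda>x. (\<phi> x + \<psi> x)\<^sup>2)"
       "(\<lambda>m. (legendre_coeff (\<lambda>x. \<phi> x - \<psi> x) m)\<^sup>2) sums ?I (\<lambda>x. (\<phi> x - \<psi> x)\<^sup>2)"
    using assms by (auto intro!: parseval_shifted_legendre_square continuous_intros)
  from sums_divide[OF sums_diff[OF this], of 4]
  have "(\<lambda>m. legendre_coeff \<phi> m * legendre_coeff \<psi> m) sums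
      ((?I (\<lambda>x. (\<phi> x + \<psi> x)\<^sup>2) - ?I (\<lambda>x. (\<phi> x - \<psi> x)\<^sup>2)) / 4)"
    unfolding add diff by (simp add: power2_eq_square algebra_simps)
  also have "?I (\<lambda>x. (\<phi> x + \<psi> x)\<^sup>2) - ?I (\<lambda>x. (\<phi> x - \<psi> x)\<^sup>2) =
      ?I (\<lambda>x. (\<phi> x + \<psi> x)\<^sup>2 - (\<phi> x - \<psi> x)\<^sup>2)"
    using assms by (intro integral_diff[symmetric] int continuous_intros)
  also have "\<dots> = ?I (\<lambda>x. 4 * (\<phi> x * \<psi> x))"
    by (simp add: power2_eq_square algebra_simps)
  finally show ?thesis by simp
qed

text \<open>The bilinear form (without complex conjugation), as it occurs in products of coefficient matrices.\<close>

theorem parseval_shifted_legendre: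
  fixes \<phi> \<psi> :: "real \<Rightarrow> complex"
  assumes cont: "continuous_on {0..1} \<phi>" "continuous_on {0..1} \<psi>"
  shows "(\<lambda>m. integral {0..1} (\<lambda>x. \<phi> x * of_real (poly (shifted_legendre m) x)) *
              integral {0..1} (\<lambda>x. of_real (poly (shifted_legendre m) x) * \<psi> x)) sums
         integral {0..1} (\<lambda>x. \<phi> x * \<psi> x)"
proof -
  have coeff: "integral {0..1} (\<lambda>x. f x * of_real (poly (shifted_legendre m) x)) =
      Complex (legendre_coeff (\<lambda>x. Re (f x)) m) (legendre_coeff (\<lambda>x. Im (f x)) m)"
    if "continuous_on {0..1} f" for f :: "real \<Rightarrow> complex" and m
  proof (rule complex_eqI)
    have "(\<lambda>x. f x * of_real (poly (shifted_legendre m) x)) integrable_on {0..1}"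
      using that by (intro integrable_continuous_real continuous_intros)
    from integral_linear[OF this bounded_linear_Re] integral_linear[OF this bounded_linear_Im]
    show "Re (integral {0..1} (\<lambda>x. f x * of_real (poly (shifted_legendre m) x))) =
        Re (Complex (legendre_coeff (\<lambda>x. Re (f x)) m) (legendre_coeff (\<lambda>x. Im (f x)) m))"
      "Im (integral {0..1} (\<lambda>x. f x * of_real (poly (shifted_legendre m) x))) =
        Im (Complex (legendre_coeff (\<lambda>x. Re (f x)) m) (legendre_coeff (\<lambda>x. Im (f x)) m))"
      by (simp_all add: o_def)
  qed
  let ?I = "\<lambda>f g. integral {0..1} (\<lambda>x. f (\<phi> x) * g (\<psi> x))"
  have split: "integral {0..1} (\<lambda>x. \<phi> x * \<psi> x) =
      Complex (?I Re Re - ?I Im Im) (?I Re Im + ?I Im Re)"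
  proof (rule complex_eqI)
    have i: "(\<lambda>x. \<phi> x * \<psi> x) integrable_on {0..1}"
      using cont by (intro integrable_continuous_real continuous_intros)
    have "Re (integral {0..1} (\<lambda>x. \<phi> x * \<psi> x)) =
        integral {0..1} (\<lambda>x. Re (\<phi> x) * Re (\<psi> x) - Im (\<phi> x) * Im (\<psi> x))"
      using integral_linear[OF i bounded_linear_Re] by (simp add: o_def)
    also have "\<dots> = ?I Re Re - ?I Im Im"
      using cont by (intro integral_diff integrable_continuous_real continuous_intros)
    finally show "Re (integral {0..1} (\<lambda>x. \<phi> x * \<psi> x)) =
        Re (Complex (?I Re Re - ?I Im Im) (?I Re Im + ?I Im Re))"
      by simp
    have "Im (integral {0..1} (\<lambda>x. \<phi> x * \<psi> x)) =
        integral {0..1} (\<lambda>x. Re (\<phi> x) * Im (\<psi> x) + Im (\<phi> x) * Re (\<psi> x))"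
      using integral_linear[OF i bounded_linear_Im] by (simp add: o_def)
    also have "\<dots> = ?I Re Im + ?I Im Re"
      using cont by (intro integral_add integrable_continuous_real continuous_intros)
    finally show "Im (integral {0..1} (\<lambda>x. \<phi> x * \<psi> x)) =
        Im (Complex (?I Re Re - ?I Im Im) (?I Re Im + ?I Im Re))"
      by simp
  qed
  have re_im: "continuous_on {0..1} (\<lambda>x. Re (\<phi> x))" "continuous_on {0..1} (\<lambda>x. Im (\<phi> x))"
    "continuous_on {0..1} (\<lambda>x. Re (\<psi> x))" "continuous_on {0..1} (\<lambda>x. Im (\<psi> x))"
    using cont by (intro continuous_intros; simp)+
  note P = parseval_shifted_legendre_real
  show ?thesis
    unfolding split mult.commute[of "of_real _" "\<psi> _"] coeff[OF cont(1)] coeff[OF cont(2)]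
    using sums_diff[OF P[OF re_im(1,3)] P[OF re_im(2,4)]]
      sums_add[OF P[OF re_im(1,4)] P[OF re_im(2,3)]]
    by (simp add: sums_complex_iff)
qed

section \<open>Volterra kernels\<close>

definition lower_triangle :: "(real \<times> real) set" where
  "lower_triangle = {(t, s). 0 \<le> s \<and> s \<le> t \<and> t \<le> 1}"

text \<open>A class of kernels that contains the kernels of \<open>D0_t\<close> and is closed under \<open>\<star>\<close> and under uniform
limits, hence also contains the sum of the Neumann series. Continuity is demanded on the closed triangle
only, because the kernels jump across the diagonal.\<close>

definition volterra :: "kernel \<Rightarrow> bool" where
  "volterra f \<longleftrightarrow> continuous_on lower_triangle (\<lambda>(t, s). f t s) \<and>
     (\<forall>t\<in>unit_ivl. \<forall>s\<in>unit_ivl. t < s \<longrightarrow> f t s = 0)"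

text \<open>The values of a kernel outside the unit square are arbitrary, so identities between kernels hold only in
this sense.\<close>

definition kernel_eq :: "kernel \<Rightarrow> kernel \<Rightarrow> bool" where
  "kernel_eq f g \<longleftrightarrow> (\<forall>t\<in>unit_ivl. \<forall>s\<in>unit_ivl. f t s = g t s)"

lemma kernel_eqD: "kernel_eq f g \<Longrightarrow> t \<in> unit_ivl \<Longrightarrow> s \<in> unit_ivl \<Longrightarrow> f t s = g t s"
  by (simp add: kernel_eq_def)

lemma volterra_zero: "volterra f \<Longrightarrow> t \<in> unit_ivl \<Longrightarrow> s \<in> unit_ivl \<Longrightarrow> t < s \<Longrightarrow> f t s = 0"
  by (simp add: volterra_def)

lemma volterra_continuous_compose:
  assumes "volterra f" "continuous_on S a" "continuous_on S b"
    "\<And>x. x \<in> S \<Longrightarrow> 0 \<le> b x \<and> b x \<le> a x \<and> a x \<le> 1"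
  shows "continuous_on S (\<lambda>x. f (a x) (b x))"
proof -
  have "continuous_on lower_triangle (\<lambda>(t, s). f t s)" using assms(1) by (simp add: volterra_def)
  from continuous_on_compose2[OF this continuous_on_Pair[OF assms(2,3)]]
  show ?thesis using assms(4) by (auto simp: lower_triangle_def)
qed

lemma volterra_cong:
  assumes "volterra f" "kernel_eq f g"
  shows "volterra g"
proof -
  have "continuous_on lower_triangle (\<lambda>(t, s). f t s) = continuous_on lower_triangle (\<lambda>(t, s). g t s)"
    using assms(2) by (intro continuous_on_cong) (auto simp: lower_triangle_def kernel_eq_def)
  thus ?thesis using assms by (auto simp: volterra_def kernel_eq_def)
qed

lemma volterra_0 [intro, simp]: "volterra (\<lambda>t s. 0)"
  by (simp add: volterra_def)

lemma volterra_add [intro]: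
  "volterra f \<Longrightarrow> volterra g \<Longrightarrow> volterra (\<lambda>t s. f t s + g t s)"
  by (auto simp: volterra_def split_def intro!: continuous_on_add)

lemma volterra_mult_left [intro]: "volterra f \<Longrightarrow> volterra (\<lambda>t s. c * f t s)"
  by (auto simp: volterra_def split_def intro!: continuous_on_mult)

lemma volterra_sum [intro]:
  "(\<And>i. i \<in> I \<Longrightarrow> volterra (f i)) \<Longrightarrow> volterra (\<lambda>t s. \<Sum>i\<in>I. f i t s)"
  by (auto simp: volterra_def split_def intro!: continuous_on_sum)

lemma volterra_heaviside:
  assumes "continuous_on lower_triangle (\<lambda>(t, s). h t s)"
  shows "volterra (\<lambda>t s. h t s * heaviside (t - s))"
proof -
  have "continuous_on lower_triangle (\<lambda>(t, s). h t s * heaviside (t - s)) =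
        continuous_on lower_triangle (\<lambda>(t, s). h t s)"
    by (intro continuous_on_cong) (auto simp: lower_triangle_def heaviside_def)
  thus ?thesis using assms by (auto simp: volterra_def heaviside_def)
qed

lemma volterra_col_heaviside:
  assumes "continuous_on unit_ivl v"
  shows "volterra (\<lambda>t s. v t * heaviside (t - s))"
  by (rule volterra_heaviside, unfold split_def, rule continuous_on_compose2[OF assms])
     (auto simp: lower_triangle_def intro!: continuous_intros)

lemma volterra_row_heaviside:
  assumes "continuous_on unit_ivl u"
  shows "volterra (\<lambda>t s. u s * heaviside (t - s))"
  by (rule volterra_heaviside, unfold split_def, rule continuous_on_compose2[OF assms])
     (auto simp: lower_triangle_def intro!: continuous_intros)

lemma compact_lower_triangle: "compact lower_triangle"
proof -
  have cl: "closed {p :: real \<times> real. 0 \<le> snd p \<and> snd p \<le> fst p \<and> fst p \<le> 1}"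
    by (intro closed_Collect_conj closed_Collect_le continuous_intros)
  have eq: "lower_triangle = {0..1} \<times> {0..1} \<inter> {p. 0 \<le> snd p \<and> snd p \<le> fst p \<and> fst p \<le> 1}"
    by (auto simp: lower_triangle_def)
  show ?thesis
    unfolding eq by (intro compact_Int_closed compact_Times compact_Icc cl)
qed

lemma volterra_bounded:
  assumes "volterra f"
  obtains M where "M \<ge> 0" "\<And>t s. t \<in> unit_ivl \<Longrightarrow> s \<in> unit_ivl \<Longrightarrow> norm (f t s) \<le> M"
proof -
  have "compact ((\<lambda>(t, s). f t s) ` lower_triangle)"
    using assms compact_lower_triangle by (intro compact_continuous_image) (auto simp: volterra_def)
  from compact_imp_bounded[OF this]
  obtain M where "\<forall>y\<in>(\<lambda>(t, s). f t s) ` lower_triangle. norm y \<le> M"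
    unfolding bounded_iff by blast
  hence M: "norm (f (fst x) (snd x)) \<le> M" if "x \<in> lower_triangle" for x
    using that by (auto simp: split_def)
  have "norm (f t s) \<le> max M 0" if "t \<in> unit_ivl" "s \<in> unit_ivl" for t s
    using M[of "(t, s)"] volterra_zero[OF assms that] that
    by (cases "t < s") (auto simp: lower_triangle_def max.coboundedI1)
  thus thesis by (rule that[of "max M 0", rotated]) auto
qed

subsection \<open>The \<open>\<star>\<close>-product of Volterra kernels\<close>

text \<open>Products of Volterra kernels are continuous on \<open>[s, t]\<close> and vanish on the rest of \<open>[0, 1]\<close>.\<close>

lemma set_integral_unit_ivl_restrict:
  fixes h :: "real \<Rightarrow> complex"
  assumes "continuous_on {a..b} h" "a \<le> b \<Longrightarrow> 0 \<le> a \<and> b \<le> 1"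
    "\<And>x. x \<in> unit_ivl \<Longrightarrow> x \<notin> {a..b} \<Longrightarrow> h x = 0"
  shows "set_integrable lborel unit_ivl h"
    and "(LBINT x:unit_ivl. h x) = integral {a..b} h"
proof -
  have eq: "(\<lambda>x. indicator unit_ivl x *\<^sub>R h x) = (\<lambda>x. indicator {a..b} x *\<^sub>R h x)"
  proof
    show "indicator unit_ivl x *\<^sub>R h x = indicator {a..b} x *\<^sub>R h x" for x
      using assms(2) assms(3)[of x] by (cases "x \<in> {a..b}"; cases "x \<in> unit_ivl") auto
  qed
  have i: "set_integrable lborel {a..b} h"
    by (rule borel_integrable_atLeastAtMost') fact
  thus "set_integrable lborel unit_ivl h"
    by (simp add: set_integrable_def eq)
  show "(LBINT x:unit_ivl. h x) = integral {a..b} h"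
    using set_borel_integral_eq_integral(2)[OF i] by (simp add: set_lebesgue_integral_def eq)
qed

lemma set_integral_unit_ivl_continuous:
  fixes h :: "real \<Rightarrow> complex"
  assumes "continuous_on unit_ivl h"
  shows "(LBINT x:unit_ivl. h x) = integral unit_ivl h"
  by (rule set_integral_unit_ivl_restrict) (use assms in auto)

lemma kernel_star_cong:
  assumes "kernel_eq f f'" "kernel_eq g g'"
  shows "kernel_eq (kernel_star f g) (kernel_star f' g')"
  using assms
  by (auto simp: kernel_eq_def kernel_star_def intro!: set_lebesgue_integral_cong)

lemma volterra_product_continuous:
  assumes "volterra f" "volterra g" "0 \<le> s" "t \<le> 1"
  shows "continuous_on {s..t} (\<lambda>\<tau>. f t \<tau> * g \<tau> s)"
  using assms
  by (intro continuous_on_mult volterra_continuous_compose[of f] volterra_continuous_compose[of g]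
        continuous_intros) auto

lemma
  assumes f: "volterra f" and g: "volterra g" and t: "t \<in> unit_ivl" and s: "s \<in> unit_ivl"
  shows kernel_star_integrable: "set_integrable lborel unit_ivl (\<lambda>\<tau>. f t \<tau> * g \<tau> s)"
    and kernel_star_eq_integral: "kernel_star f g t s = integral {s..t} (\<lambda>\<tau>. f t \<tau> * g \<tau> s)"
proof -
  have c: "continuous_on {s..t} (\<lambda>\<tau>. f t \<tau> * g \<tau> s)"
    using volterra_product_continuous[OF f g] t s by auto
  have z: "f t \<tau> * g \<tau> s = 0" if "\<tau> \<in> unit_ivl" "\<tau> \<notin> {s..t}" for \<tau>
    using volterra_zero[OF f t that(1)] volterra_zero[OF g that(1) s] that by force
  show "set_integrable lborel unit_ivl (\<lambda>\<tau>. f t \<tau> * g \<tau> s)"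
    by (rule set_integral_unit_ivl_restrict[OF c _ z]) (use t s in auto)
  show "kernel_star f g t s = integral {s..t} (\<lambda>\<tau>. f t \<tau> * g \<tau> s)"
    unfolding kernel_star_def
    by (rule set_integral_unit_ivl_restrict[OF c _ z]) (use t s in auto)
qed

text \<open>The substitution \<open>\<tau> = s + u (t - s)\<close> turns the integral over the moving interval \<open>[s, t]\<close> into
\<open>t - s\<close> times an integral over \<open>[0, 1]\<close>, whose integrand is jointly continuous in \<open>(t, s)\<close> and
\<open>u\<close>.\<close>

lemma volterra_kernel_star [intro]:
  assumes f: "volterra f" and g: "volterra g"
  shows "volterra (kernel_star f g)"
  unfolding volterra_def
proof (intro conjI ballI impI)
  fix t s :: real
  assume "t \<in> unit_ivl" "s \<in> unit_ivl" "t < s"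
  thus "kernel_star f g t s = 0" using kernel_star_eq_integral[OF f g] by simp
next
  define h where "h = (\<lambda>p u. f (fst p) (snd p + u * (fst p - snd p)) *
                             g (snd p + u * (fst p - snd p)) (snd p))"
  have mid: "s \<le> s + u * (t - s)" "s + u * (t - s) \<le> t"
    if "s \<le> t" "0 \<le> u" "u \<le> 1" for s t u :: real
    using that mult_left_le_one_le[of "t - s" u] by auto
  have ends: "0 \<le> snd p" "snd p \<le> fst p" "fst p \<le> 1" if "p \<in> lower_triangle" for p
    using that by (auto simp: lower_triangle_def)
  define m :: "(real \<times> real) \<times> real \<Rightarrow> real"
    where "m = (\<lambda>(p, u). snd p + u * (fst p - snd p))"
  have m: "continuous_on X m" for X
    unfolding m_def split_def by (intro continuous_intros)
  have mm: "snd (fst q) \<le> m q" "m q \<le> fst (fst q)" "0 \<le> m q" "m q \<le> 1"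
    if q: "q \<in> lower_triangle \<times> cbox 0 1" for q
  proof -
    obtain p u where pu: "q = (p, u)" "p \<in> lower_triangle" "0 \<le> u" "u \<le> 1" using q by auto
    show a: "snd (fst q) \<le> m q" and b: "m q \<le> fst (fst q)"
      using mid[OF ends(2) pu(3,4)] pu by (auto simp: m_def)
    show "0 \<le> m q" "m q \<le> 1"
      using a b ends[OF pu(2)] pu(1) by auto
  qed
  have "continuous_on (lower_triangle \<times> cbox 0 1)
      (\<lambda>q. f (fst (fst q)) (m q) * g (m q) (snd (fst q)))"
    by (rule continuous_on_mult; rule volterra_continuous_compose[OF f] volterra_continuous_compose[OF g])
       (use m mm ends in \<open>auto intro!: continuous_intros\<close>)
  hence "continuous_on (lower_triangle \<times> cbox 0 1) (\<lambda>(p, u). h p u)"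
    by (simp add: h_def m_def split_def)
  from integral_continuous_on_param[OF this]
  have c: "continuous_on lower_triangle (\<lambda>p. (fst p - snd p) *\<^sub>R integral {0..1} (h p))"
    by (intro continuous_intros) simp
  have "kernel_star f g t s = (t - s) *\<^sub>R integral {0..1} (h (t, s))"
    if ts: "(t, s) \<in> lower_triangle" for t s
  proof -
    have ts': "0 \<le> s" "s \<le> t" "t \<le> 1" using ts by (auto simp: lower_triangle_def)
    have "((\<lambda>u. (t - s) *\<^sub>R (f t (s + u * (t - s)) * g (s + u * (t - s)) s)) has_integral
        integral {s + 0 * (t - s)..s + 1 * (t - s)} (\<lambda>\<tau>. f t \<tau> * g \<tau> s)) {0..1}"
      by (rule has_integral_substitution[where c = s and d = t])
         (use ts' mid in \<open>auto intro!: derivative_eq_intros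
            volterra_product_continuous[OF f g]\<close>)
    hence "integral {s..t} (\<lambda>\<tau>. f t \<tau> * g \<tau> s) = integral {0..1} (\<lambda>u. (t - s) *\<^sub>R h (t, s) u)"
      by (simp add: h_def has_integral_iff)
    thus ?thesis using kernel_star_eq_integral[OF f g, of t s] ts' by simp
  qed
  hence "continuous_on lower_triangle (\<lambda>(t, s). kernel_star f g t s) =
      continuous_on lower_triangle (\<lambda>p. (fst p - snd p) *\<^sub>R integral {0..1} (h p))"
    by (intro continuous_on_cong) auto
  thus "continuous_on lower_triangle (\<lambda>(t, s). kernel_star f g t s)" using c by simp
qed

text \<open>Fubini for an integrand that is continuous on a compact part of the square and zero on the rest; the
jump along the boundary of that part does not affect integrability.\<close>

lemma set_integral_swap_unit_square:
  fixes h :: "real \<Rightarrow> real \<Rightarrow> complex"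
  assumes S: "compact S" "S \<subseteq> unit_ivl \<times> unit_ivl"
    and h: "continuous_on S (\<lambda>(x, y). h x y)"
    and z: "\<And>x y. x \<in> unit_ivl \<Longrightarrow> y \<in> unit_ivl \<Longrightarrow> (x, y) \<notin> S \<Longrightarrow> h x y = 0"
  shows "(LBINT x:unit_ivl. LBINT y:unit_ivl. h x y) = (LBINT y:unit_ivl. LBINT x:unit_ivl. h x y)"
proof -
  define H where "H = (\<lambda>x y. indicator S (x, y) *\<^sub>R h x y)"
  have H: "indicator unit_ivl x *\<^sub>R (indicator unit_ivl y *\<^sub>R h x y) = H x y" for x y
    using S(2) z[of x y] by (auto simp: H_def indicator_def)
  have "integrable lborel (\<lambda>p. indicator S p *\<^sub>R (case p of (x, y) \<Rightarrow> h x y))"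
    using borel_integrable_compact[OF S(1) h] by simp
  also have "(\<lambda>p. indicator S p *\<^sub>R (case p of (x, y) \<Rightarrow> h x y)) = case_prod H"
    by (auto simp: H_def fun_eq_iff)
  finally have "integrable (lborel \<Otimes>\<^sub>M lborel) (case_prod H)"
    by (simp add: lborel_prod)
  from lborel_pair.Fubini_integral[OF this]
  have "(LBINT y. LBINT x. H x y) = (LBINT x. LBINT y. H x y)" .
  moreover have "(LBINT x:unit_ivl. LBINT y:unit_ivl. h x y) = (LBINT x. LBINT y. H x y)"
    unfolding set_lebesgue_integral_def integral_scaleR_right[symmetric] H ..
  moreover have "(LBINT y:unit_ivl. LBINT x:unit_ivl. h x y) = (LBINT y. LBINT x. H x y)"
    unfolding set_lebesgue_integral_def integral_scaleR_right[symmetric]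
    by (subst scaleR_left_commute) (simp only: H)
  ultimately show ?thesis by simp
qed

theorem kernel_star_assoc:
  assumes f: "volterra f" and g: "volterra g" and h: "volterra h"
  shows "kernel_eq (kernel_star (kernel_star f g) h) (kernel_star f (kernel_star g h))"
  unfolding kernel_eq_def
proof (intro ballI)
  fix t s :: real
  assume t: "t \<in> unit_ivl" and s: "s \<in> unit_ivl"
  define S where "S = {p :: real \<times> real. s \<le> snd p \<and> snd p \<le> fst p \<and> fst p \<le> t}"
  have cl: "closed S"
    unfolding S_def by (intro closed_Collect_conj closed_Collect_le continuous_intros)
  have sub: "S \<subseteq> unit_ivl \<times> unit_ivl" using t s by (auto simp: S_def)
  have S: "compact S"
    using compact_Int_closed[OF compact_Times[OF compact_Icc compact_Icc] cl, of 0 1 0 1] sub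
    by (simp add: inf.absorb2)
  have "kernel_star f (kernel_star g h) t s =
      (LBINT \<sigma>:unit_ivl. LBINT \<tau>:unit_ivl. f t \<sigma> * (g \<sigma> \<tau> * h \<tau> s))"
    by (simp add: kernel_star_def)
  also have "\<dots> = (LBINT \<tau>:unit_ivl. LBINT \<sigma>:unit_ivl. f t \<sigma> * (g \<sigma> \<tau> * h \<tau> s))"
  proof (rule set_integral_swap_unit_square[OF S sub])
    show "continuous_on S (\<lambda>(\<sigma>, \<tau>). f t \<sigma> * (g \<sigma> \<tau> * h \<tau> s))"
      unfolding split_def using t s
      by (intro continuous_on_mult volterra_continuous_compose[OF f]
            volterra_continuous_compose[OF g] volterra_continuous_compose[OF h] continuous_intros)
         (auto simp: S_def)
    show "f t \<sigma> * (g \<sigma> \<tau> * h \<tau> s) = 0"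
      if "\<sigma> \<in> unit_ivl" "\<tau> \<in> unit_ivl" "(\<sigma>, \<tau>) \<notin> S" for \<sigma> \<tau>
      using volterra_zero[OF f t that(1)] volterra_zero[OF g that(1,2)]
        volterra_zero[OF h that(2) s] that(3) by (fastforce simp: S_def)
  qed
  also have "\<dots> = kernel_star (kernel_star f g) h t s"
    by (simp add: kernel_star_def mult.assoc flip: set_integral_mult_left)
  finally show "kernel_star (kernel_star f g) h t s = kernel_star f (kernel_star g h) t s" by simp
qed

lemma kernel_star_add_left:
  assumes "volterra f" "volterra f'" "volterra g" "t \<in> unit_ivl" "s \<in> unit_ivl"
  shows "kernel_star (\<lambda>t s. f t s + f' t s) g t s = kernel_star f g t s + kernel_star f' g t s"
  using kernel_star_integrable[OF assms(1,3-5)] kernel_star_integrable[OF assms(2-5)]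
  by (simp add: kernel_star_def distrib_right)

lemma kernel_star_add_right:
  assumes "volterra f" "volterra g" "volterra g'" "t \<in> unit_ivl" "s \<in> unit_ivl"
  shows "kernel_star f (\<lambda>t s. g t s + g' t s) t s = kernel_star f g t s + kernel_star f g' t s"
  using kernel_star_integrable[OF assms(1,2,4,5)] kernel_star_integrable[OF assms(1,3-5)]
  by (simp add: kernel_star_def distrib_left)

lemma kernel_star_mult_left: "kernel_star (\<lambda>t s. c * f t s) g t s = c * kernel_star f g t s"
  by (simp add: kernel_star_def mult.assoc)

lemma kernel_star_mult_right: "kernel_star f (\<lambda>t s. c * g t s) t s = c * kernel_star f g t s"
  by (simp add: kernel_star_def mult.left_commute)

lemma kernel_star_0_left [simp]: "kernel_star (\<lambda>t s. 0) g t s = 0"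
  and kernel_star_0_right [simp]: "kernel_star f (\<lambda>t s. 0) t s = 0"
  by (simp_all add: kernel_star_def)

text \<open>In the norm weighted by \<open>exp (a (t - s))\<close>, the operator \<open>g \<mapsto> f \<star> g\<close> has norm at most \<open>M / a\<close>, which
becomes as small as desired for large \<open>a\<close>. This is how quasinilpotency of Volterra operators enters.\<close>

lemma norm_kernel_star_le:
  assumes f: "volterra f" and g: "volterra g" and t: "t \<in> unit_ivl" and s: "s \<in> unit_ivl"
    and st: "s \<le> t" and a: "a > 0"
    and M: "\<And>\<tau>. \<tau> \<in> {s..t} \<Longrightarrow> norm (f t \<tau>) \<le> M"
    and B: "\<And>\<tau>. \<tau> \<in> {s..t} \<Longrightarrow> norm (g \<tau> s) \<le> B * exp (a * (\<tau> - s))"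
  shows "norm (kernel_star f g t s) \<le> M * B / a * exp (a * (t - s))"
proof -
  have "norm (f t s) \<le> M" "norm (g s s) \<le> B" using M[of s] B[of s] st by auto
  hence MB: "M \<ge> 0" "B \<ge> 0" by (meson norm_ge_zero order_trans)+
  have I: "((\<lambda>\<tau>. M * (B * exp (a * (\<tau> - s)))) has_integral
      (M * B / a * exp (a * (t - s)) - M * B / a * exp (a * (s - s)))) {s..t}"
    using a by (intro fundamental_theorem_of_calculus[OF st])
      (auto intro!: derivative_eq_intros simp flip: has_real_derivative_iff_has_vector_derivative)
  have "norm (integral {s..t} (\<lambda>\<tau>. f t \<tau> * g \<tau> s)) \<le>
      integral {s..t} (\<lambda>\<tau>. M * (B * exp (a * (\<tau> - s))))"
  proof (rule integral_norm_bound_integral)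
    show "(\<lambda>\<tau>. f t \<tau> * g \<tau> s) integrable_on {s..t}"
      using volterra_product_continuous[OF f g] t s by (intro integrable_continuous_real) auto
    show "(\<lambda>\<tau>. M * (B * exp (a * (\<tau> - s)))) integrable_on {s..t}"
      using I by blast
    show "norm (f t \<tau> * g \<tau> s) \<le> M * (B * exp (a * (\<tau> - s)))" if "\<tau> \<in> {s..t}" for \<tau>
      unfolding norm_mult using M[OF that] B[OF that] MB by (intro mult_mono) auto
  qed
  also have "\<dots> = M * B / a * exp (a * (t - s)) - M * B / a"
    using integral_unique[OF I] by (simp only: diff_self mult_zero_right exp_zero mult_1_right)
  also have "\<dots> \<le> M * B / a * exp (a * (t - s))"
    using MB a by simp
  finally show ?thesis using kernel_star_eq_integral[OF f g t s] by simp
qed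

subsection \<open>Series of Volterra kernels\<close>

text \<open>A summable majorant is part of the definition: it gives continuity of the sum on the triangle and
termwise integration.\<close>

definition kernel_sums :: "(nat \<Rightarrow> kernel) \<Rightarrow> kernel \<Rightarrow> bool" where
  "kernel_sums G g \<longleftrightarrow> (\<forall>m. volterra (G m)) \<and>
     (\<exists>B. summable B \<and> (\<forall>m. \<forall>t\<in>unit_ivl. \<forall>s\<in>unit_ivl. norm (G m t s) \<le> B m)) \<and>
     (\<forall>t\<in>unit_ivl. \<forall>s\<in>unit_ivl. (\<lambda>m. G m t s) sums g t s)"

lemma volterra_kernel_sums:
  assumes "kernel_sums G g"
  shows "volterra g"
  unfolding volterra_def
proof (intro conjI ballI impI)
  obtain B where B: "summable B"
      "\<And>m t s. t \<in> unit_ivl \<Longrightarrow> s \<in> unit_ivl \<Longrightarrow> norm (G m t s) \<le> B m"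
    using assms by (auto simp: kernel_sums_def)
  have G: "volterra (G m)" for m using assms by (simp add: kernel_sums_def)
  have g: "(\<lambda>m. G m t s) sums g t s" if "t \<in> unit_ivl" "s \<in> unit_ivl" for t s
    using assms that by (simp add: kernel_sums_def)
  show "g t s = 0" if "t \<in> unit_ivl" "s \<in> unit_ivl" "t < s" for t s
    using g[OF that(1,2)] volterra_zero[OF G that] by (simp add: sums_0 sums_unique2)
  have "uniform_limit lower_triangle (\<lambda>n p. \<Sum>m<n. G m (fst p) (snd p))
      (\<lambda>p. \<Sum>m. G m (fst p) (snd p)) sequentially"
    by (rule Weierstrass_m_test[OF _ B(1)]) (auto simp: lower_triangle_def intro!: B(2))
  hence "continuous_on lower_triangle (\<lambda>p. \<Sum>m. G m (fst p) (snd p))"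
    by (rule uniform_limit_theorem[rotated])
       (use G in \<open>auto simp: volterra_def split_def intro!: continuous_on_sum always_eventually\<close>)
  also have "continuous_on lower_triangle (\<lambda>p. \<Sum>m. G m (fst p) (snd p)) =
      continuous_on lower_triangle (\<lambda>(t, s). g t s)"
    by (intro continuous_on_cong) (auto simp: lower_triangle_def intro!: sums_unique[symmetric] g)
  finally show "continuous_on lower_triangle (\<lambda>(t, s). g t s)" .
qed

lemma set_integral_sums_bounded:
  fixes h :: "nat \<Rightarrow> real \<Rightarrow> complex"
  assumes int: "\<And>m. set_integrable lborel unit_ivl (h m)"
    and B: "summable B" "\<And>m x. x \<in> unit_ivl \<Longrightarrow> norm (h m x) \<le> B m"
    and sums: "\<And>x. x \<in> unit_ivl \<Longrightarrow> (\<lambda>m. h m x) sums H x"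
  shows "(\<lambda>m. LBINT x:unit_ivl. h m x) sums (LBINT x:unit_ivl. H x)"
proof -
  have norm_le: "norm (indicator unit_ivl x *\<^sub>R h m x) \<le> B m * indicator unit_ivl x" for m x
    using B(2) by (auto simp: indicator_def)
  have Bnn: "B m \<ge> 0" for m
    using B(2)[of 0 m] norm_ge_zero[of "h m 0"] by (simp del: norm_ge_zero)
  have "(LBINT x. norm (indicator unit_ivl x *\<^sub>R h m x)) \<le> (LBINT x. B m * indicator unit_ivl x)" for m
    using int norm_le
    by (intro integral_mono integrable_norm integrable_mult_right integrable_real_indicator)
       (auto simp: set_integrable_def)
  hence le: "(LBINT x. norm (indicator unit_ivl x *\<^sub>R h m x)) \<le> B m" for m
    by simp
  have "(\<lambda>m. LBINT x. indicator unit_ivl x *\<^sub>R h m x) sums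
      (LBINT x. \<Sum>m. indicator unit_ivl x *\<^sub>R h m x)"
  proof (rule sums_integral)
    show "integrable lborel (\<lambda>x. indicator unit_ivl x *\<^sub>R h m x)" for m
      using int by (simp add: set_integrable_def)
    show "AE x in lborel. summable (\<lambda>m. norm (indicator unit_ivl x *\<^sub>R h m x))"
    proof (rule AE_I2)
      fix x :: real
      show "summable (\<lambda>m. norm (indicator unit_ivl x *\<^sub>R h m x))"
        by (rule summable_comparison_test'[OF summable_mult2[OF B(1)], where N = 0])
           (use norm_le[of x] in auto)
    qed
    show "summable (\<lambda>m. LBINT x. norm (indicator unit_ivl x *\<^sub>R h m x))"
      by (rule summable_comparison_test'[OF B(1), where N = 0]) (use le in auto)
  qed
  also have "(\<lambda>x. \<Sum>m. indicator unit_ivl x *\<^sub>R h m x) = (\<lambda>x. indicator unit_ivl x *\<^sub>R H x)"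
    using sums_unique[OF sums] by (auto simp: indicator_def fun_eq_iff)
  finally show ?thesis by (simp add: set_lebesgue_integral_def)
qed

lemma kernel_star_sums_right:
  assumes f: "volterra f" and G: "kernel_sums G g" and t: "t \<in> unit_ivl" and s: "s \<in> unit_ivl"
  shows "(\<lambda>m. kernel_star f (G m) t s) sums kernel_star f g t s"
proof -
  obtain B where B: "summable B"
      "\<And>m t s. t \<in> unit_ivl \<Longrightarrow> s \<in> unit_ivl \<Longrightarrow> norm (G m t s) \<le> B m"
    using G by (auto simp: kernel_sums_def)
  obtain M where M: "M \<ge> 0" "\<And>t s. t \<in> unit_ivl \<Longrightarrow> s \<in> unit_ivl \<Longrightarrow> norm (f t s) \<le> M"
    using volterra_bounded[OF f] by blast
  show ?thesis
    unfolding kernel_star_def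
  proof (rule set_integral_sums_bounded)
    show "set_integrable lborel unit_ivl (\<lambda>\<tau>. f t \<tau> * G m \<tau> s)" for m
      using kernel_star_integrable[OF f _ t s] G by (simp add: kernel_sums_def)
    show "summable (\<lambda>m. M * B m)" using B(1) by (rule summable_mult)
    show "norm (f t x * G m x s) \<le> M * B m" if "x \<in> unit_ivl" for m x
      unfolding norm_mult using M t s that B by (intro mult_mono) auto
    show "(\<lambda>m. f t x * G m x s) sums (f t x * g x s)" if "x \<in> unit_ivl" for x
      using G that s by (intro sums_mult) (simp add: kernel_sums_def)
  qed
qed

lemma kernel_star_sums_left:
  assumes f: "volterra f" and G: "kernel_sums G g" and t: "t \<in> unit_ivl" and s: "s \<in> unit_ivl"
  shows "(\<lambda>m. kernel_star (G m) f t s) sums kernel_star g f t s"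
proof -
  obtain B where B: "summable B"
      "\<And>m t s. t \<in> unit_ivl \<Longrightarrow> s \<in> unit_ivl \<Longrightarrow> norm (G m t s) \<le> B m"
    using G by (auto simp: kernel_sums_def)
  obtain M where M: "M \<ge> 0" "\<And>t s. t \<in> unit_ivl \<Longrightarrow> s \<in> unit_ivl \<Longrightarrow> norm (f t s) \<le> M"
    using volterra_bounded[OF f] by blast
  show ?thesis
    unfolding kernel_star_def
  proof (rule set_integral_sums_bounded)
    show "set_integrable lborel unit_ivl (\<lambda>\<tau>. G m t \<tau> * f \<tau> s)" for m
      using kernel_star_integrable[OF _ f t s] G by (simp add: kernel_sums_def)
    show "summable (\<lambda>m. B m * M)" using B(1) by (rule summable_mult2)
    show "norm (G m t x * f x s) \<le> B m * M" if "x \<in> unit_ivl" for m x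
      unfolding norm_mult using M t s that B order_trans[OF norm_ge_zero B(2)]
      by (intro mult_mono) auto
    show "(\<lambda>m. G m t x * f x s) sums (g t x * f x s)" if "x \<in> unit_ivl" for x
      using G that t by (intro sums_mult2) (simp add: kernel_sums_def)
  qed
qed

section \<open>Coefficient matrices turn \<open>\<star>\<close>-products into matrix products\<close>

abbreviation legendre :: "nat \<Rightarrow> real \<Rightarrow> complex" where
  "legendre i x \<equiv> complex_of_real (poly (shifted_legendre i) x)"

text \<open>With these two kernels the integrals against \<open>p\<^sub>i\<close> become \<open>\<star>\<close>-products: multiplication from the
left evaluated at \<open>t = 1\<close>, and from the right evaluated at \<open>s = 0\<close>, where the Heaviside factor is
\<open>1\<close> on all of \<open>[0, 1]\<close>. Continuity of such integrals and interchange of the order of integration then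
follow from closure and associativity of \<open>\<star>\<close>.\<close>

abbreviation legendre_row :: "nat \<Rightarrow> kernel" where
  "legendre_row i \<equiv> (\<lambda>t s. legendre i s * heaviside (t - s))"

abbreviation legendre_col :: "nat \<Rightarrow> kernel" where
  "legendre_col i \<equiv> (\<lambda>t s. legendre i t * heaviside (t - s))"

lemma volterra_legendre_row: "volterra (legendre_row i)"
  by (intro volterra_row_heaviside continuous_intros)

lemma volterra_legendre_col: "volterra (legendre_col i)"
  by (intro volterra_col_heaviside continuous_intros)

lemma kernel_star_legendre_col:
  "kernel_star f (legendre_col j) t 0 = (LBINT \<rho>:unit_ivl. f t \<rho> * legendre j \<rho>)"
  unfolding kernel_star_def by (rule set_lebesgue_integral_cong) (auto simp: heaviside_def)

lemma kernel_star_legendre_row: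
  "kernel_star (legendre_row i) f 1 s = (LBINT \<tau>:unit_ivl. legendre i \<tau> * f \<tau> s)"
  unfolding kernel_star_def by (rule set_lebesgue_integral_cong) (auto simp: heaviside_def)

lemma kernel_coeff_matrix_eq_kernel_star:
  "kernel_coeff_matrix f i j = kernel_star (legendre_row i) (kernel_star f (legendre_col j)) 1 0"
proof -
  have "(LBINT \<rho>:unit_ivl. f \<tau> \<rho> * legendre i \<tau> * legendre j \<rho>) =
      legendre i \<tau> * kernel_star f (legendre_col j) \<tau> 0" for \<tau>
    unfolding kernel_star_legendre_col set_integral_mult_right[symmetric]
    by (simp add: mult_ac)
  thus ?thesis by (simp add: kernel_coeff_matrix_def kernel_star_legendre_row)
qed

lemma kernel_coeff_matrix_cong:
  assumes "kernel_eq f g"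
  shows "kernel_coeff_matrix f = kernel_coeff_matrix g"
  using assms
  by (auto simp: kernel_coeff_matrix_def fun_eq_iff kernel_eq_def intro!: set_lebesgue_integral_cong)

text \<open>With \<open>\<phi> = (p\<^sub>i \<star> f)(1, \<cdot>)\<close> and \<open>\<psi> = (g \<star> p\<^sub>j)(\<cdot>, 0)\<close>, the entries of row \<open>i\<close> for \<open>f\<close> and of column
\<open>j\<close> for \<open>g\<close> are the Legendre coefficients of \<open>\<phi>\<close> and of \<open>\<psi>\<close>, while the entry for \<open>f \<star> g\<close> is
the integral of \<open>\<phi> \<psi>\<close>. So the product of the infinite matrices is Parseval's identity.\<close>

theorem kernel_coeff_matrix_star:
  assumes f: "volterra f" and g: "volterra g"
  shows "(\<lambda>m. kernel_coeff_matrix f i m * kernel_coeff_matrix g m j) sums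
         kernel_coeff_matrix (kernel_star f g) i j"
proof -
  note vr = volterra_legendre_row and vc = volterra_legendre_col
  define \<phi> where "\<phi> = (\<lambda>\<tau>. kernel_star (legendre_row i) f 1 \<tau>)"
  define \<psi> where "\<psi> = (\<lambda>\<tau>. kernel_star g (legendre_col j) \<tau> 0)"
  have \<phi>: "continuous_on unit_ivl \<phi>" and \<psi>: "continuous_on unit_ivl \<psi>"
    unfolding \<phi>_def \<psi>_def
    by (auto intro!: volterra_continuous_compose[OF volterra_kernel_star] vr vc f g continuous_intros)
  have \<phi>m: "integral unit_ivl (\<lambda>x. \<phi> x * legendre m x) = kernel_coeff_matrix f i m" for m
  proof -
    have "integral unit_ivl (\<lambda>x. \<phi> x * legendre m x) =
        kernel_star (kernel_star (legendre_row i) f) (legendre_col m) 1 0"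
      unfolding kernel_star_legendre_col \<phi>_def[symmetric]
      by (intro set_integral_unit_ivl_continuous[symmetric] continuous_intros \<phi>)
    thus ?thesis
      using kernel_star_assoc[OF vr f vc, of i m]
      by (simp add: kernel_eq_def kernel_coeff_matrix_eq_kernel_star)
  qed
  have \<psi>_eq: "kernel_star g (legendre_col j) \<tau> 0 = \<psi> \<tau>" for \<tau>
    by (simp add: \<psi>_def)
  have \<psi>m: "integral unit_ivl (\<lambda>x. legendre m x * \<psi> x) = kernel_coeff_matrix g m j" for m
    unfolding kernel_coeff_matrix_eq_kernel_star kernel_star_legendre_row \<psi>_eq
    by (intro set_integral_unit_ivl_continuous[symmetric] continuous_intros \<psi>)
  have "kernel_coeff_matrix (kernel_star f g) i j =
      kernel_star (legendre_row i) (kernel_star (kernel_star f g) (legendre_col j)) 1 0"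
    by (rule kernel_coeff_matrix_eq_kernel_star)
  also have "\<dots> = kernel_star (legendre_row i) (kernel_star f (kernel_star g (legendre_col j))) 1 0"
    by (rule kernel_eqD[OF kernel_star_cong[OF _ kernel_star_assoc[OF f g vc]]])
       (auto simp: kernel_eq_def)
  also have "\<dots> = kernel_star (kernel_star (legendre_row i) f) (kernel_star g (legendre_col j)) 1 0"
    by (rule kernel_eqD[OF kernel_star_assoc, symmetric]) (auto intro: vr vc f g)
  also have "\<dots> = integral unit_ivl (\<lambda>x. \<phi> x * \<psi> x)"
    unfolding kernel_star_def[of "kernel_star _ _"] \<phi>_def[symmetric] \<psi>_eq
    by (intro set_integral_unit_ivl_continuous continuous_intros \<phi> \<psi>)
  finally show ?thesis
    using parseval_shifted_legendre[OF \<phi> \<psi>] by (simp add: \<phi>m \<psi>m)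
qed

section \<open>The algebra of distributions and matrices over it\<close>

abbreviation volterra_dist :: "star_dist \<Rightarrow> bool" where
  "volterra_dist X \<equiv> volterra (kernel_part X)"

definition dist_eq :: "star_dist \<Rightarrow> star_dist \<Rightarrow> bool" where
  "dist_eq X Y \<longleftrightarrow> delta_coeff X = delta_coeff Y \<and> kernel_eq (kernel_part X) (kernel_part Y)"

lemma star_dist_simps [simp]:
  "delta_coeff (X \<star> Y) = delta_coeff X * delta_coeff Y"
  "delta_coeff (X + Y) = delta_coeff X + delta_coeff Y"
  "delta_coeff 0 = 0" "delta_coeff star_one = 1"
  "kernel_part (X + Y) = (\<lambda>t s. kernel_part X t s + kernel_part Y t s)"
  "kernel_part 0 = (\<lambda>t s. 0)" "kernel_part star_one = (\<lambda>t s. 0)"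
  by (simp_all add: star_def plus_star_dist_def zero_star_dist_def star_one_def)

lemma kernel_part_star:
  "kernel_part (X \<star> Y) = (\<lambda>t s. delta_coeff X * kernel_part Y t s
     + delta_coeff Y * kernel_part X t s + kernel_star (kernel_part X) (kernel_part Y) t s)"
  by (simp add: star_def)

lemma star_dist_sum:
  "delta_coeff (sum X I) = (\<Sum>i\<in>I. delta_coeff (X i))"
  "kernel_part (sum X I) = (\<lambda>t s. \<Sum>i\<in>I. kernel_part (X i) t s)"
  by (induction I rule: infinite_finite_induct) simp_all

lemma star_units [simp]:
  "star_one \<star> X = X" "X \<star> star_one = X" "0 \<star> X = 0" "X \<star> 0 = 0"
  by (rule star_dist.expand; simp add: kernel_part_star)+

lemma volterra_dist_star:
  "volterra_dist X \<Longrightarrow> volterra_dist Y \<Longrightarrow> volterra_dist (X \<star> Y)"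
  unfolding kernel_part_star
  by (intro volterra_add volterra_mult_left volterra_kernel_star)

lemma volterra_dist_sum:
  "(\<And>i. i \<in> I \<Longrightarrow> volterra_dist (X i)) \<Longrightarrow> volterra_dist (sum X I)"
  unfolding star_dist_sum by (rule volterra_sum)

lemma dist_eq_refl [simp]: "dist_eq X X"
  by (simp add: dist_eq_def kernel_eq_def)

lemma dist_eq_sym: "dist_eq X Y \<Longrightarrow> dist_eq Y X"
  by (simp add: dist_eq_def kernel_eq_def)

lemma dist_eq_trans [trans]: "dist_eq X Y \<Longrightarrow> dist_eq Y Z \<Longrightarrow> dist_eq X Z"
  by (simp add: dist_eq_def kernel_eq_def)

lemma dist_eq_add: "dist_eq X X' \<Longrightarrow> dist_eq Y Y' \<Longrightarrow> dist_eq (X + Y) (X' + Y')"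
  by (simp add: dist_eq_def kernel_eq_def)

lemma dist_eq_sum:
  "(\<And>i. i \<in> I \<Longrightarrow> dist_eq (X i) (Y i)) \<Longrightarrow> dist_eq (sum X I) (sum Y I)"
  by (induction I rule: infinite_finite_induct) (auto intro: dist_eq_add)

lemma dist_eq_star:
  assumes "dist_eq X X'" "dist_eq Y Y'"
  shows "dist_eq (X \<star> Y) (X' \<star> Y')"
  using assms kernel_star_cong[of "kernel_part X" "kernel_part X'" "kernel_part Y" "kernel_part Y'"]
  by (simp add: dist_eq_def kernel_eq_def kernel_part_star)

lemma dist_eq_star_add_left:
  assumes "volterra_dist X" "volterra_dist X'" "volterra_dist Y"
  shows "dist_eq ((X + X') \<star> Y) (X \<star> Y + X' \<star> Y)"
  using assms
  by (simp add: dist_eq_def kernel_eq_def kernel_part_star kernel_star_add_left algebra_simps)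

lemma dist_eq_star_add_right:
  assumes "volterra_dist X" "volterra_dist Y" "volterra_dist Y'"
  shows "dist_eq (X \<star> (Y + Y')) (X \<star> Y + X \<star> Y')"
  using assms
  by (simp add: dist_eq_def kernel_eq_def kernel_part_star kernel_star_add_right algebra_simps)

lemma dist_eq_star_sum_left:
  assumes "\<And>i. i \<in> I \<Longrightarrow> volterra_dist (X i)" "volterra_dist Y"
  shows "dist_eq ((\<Sum>i\<in>I. X i) \<star> Y) (\<Sum>i\<in>I. X i \<star> Y)"
  using assms(1)
proof (induction I rule: infinite_finite_induct)
  case (insert i I)
  have "dist_eq ((X i + sum X I) \<star> Y) (X i \<star> Y + sum X I \<star> Y)"
    using insert.prems assms(2) by (intro dist_eq_star_add_left volterra_dist_sum) auto
  also have "dist_eq (X i \<star> Y + sum X I \<star> Y) (X i \<star> Y + (\<Sum>i\<in>I. X i \<star> Y))"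
    using insert by (intro dist_eq_add) auto
  finally show ?case using insert.hyps by simp
qed simp_all

lemma dist_eq_star_sum_right:
  assumes "\<And>i. i \<in> I \<Longrightarrow> volterra_dist (Y i)" "volterra_dist X"
  shows "dist_eq (X \<star> (\<Sum>i\<in>I. Y i)) (\<Sum>i\<in>I. X \<star> Y i)"
  using assms(1)
proof (induction I rule: infinite_finite_induct)
  case (insert i I)
  have "dist_eq (X \<star> (Y i + sum Y I)) (X \<star> Y i + X \<star> sum Y I)"
    using insert.prems assms(2) by (intro dist_eq_star_add_right volterra_dist_sum) auto
  also have "dist_eq (X \<star> Y i + X \<star> sum Y I) (X \<star> Y i + (\<Sum>i\<in>I. X \<star> Y i))"
    using insert by (intro dist_eq_add) auto
  finally show ?case using insert.hyps by simp
qed simp_all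

lemma dist_eq_star_assoc:
  assumes X: "volterra_dist X" and Y: "volterra_dist Y" and Z: "volterra_dist Z"
  shows "dist_eq (X \<star> Y \<star> Z) (X \<star> (Y \<star> Z))"
proof -
  define f g h where "f = kernel_part X" and "g = kernel_part Y" and "h = kernel_part Z"
  have fgh: "volterra f" "volterra g" "volterra h"
    using assms by (simp_all add: f_def g_def h_def)
  note v = volterra_add volterra_mult_left volterra_kernel_star fgh
  have "kernel_part (X \<star> Y \<star> Z) t s = kernel_part (X \<star> (Y \<star> Z)) t s"
    if ts: "t \<in> unit_ivl" "s \<in> unit_ivl" for t s
  proof -
    have "kernel_star (\<lambda>t s. x * g t s + y * f t s + kernel_star f g t s) h t s =
        x * kernel_star g h t s + y * kernel_star f h t s + kernel_star (kernel_star f g) h t s" for x y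
      by (subst kernel_star_add_left; (intro v ts)?)+ (simp add: kernel_star_mult_left)
    moreover have "kernel_star f (\<lambda>t s. y * h t s + z * g t s + kernel_star g h t s) t s =
        y * kernel_star f h t s + z * kernel_star f g t s + kernel_star f (kernel_star g h) t s" for y z
      by (subst kernel_star_add_right; (intro v ts)?)+ (simp add: kernel_star_mult_right)
    moreover note kernel_eqD[OF kernel_star_assoc[OF fgh] ts]
    ultimately show ?thesis
      by (simp add: kernel_part_star f_def[symmetric] g_def[symmetric] h_def[symmetric]
          distrib_left ac_simps)
  qed
  thus ?thesis by (simp add: dist_eq_def kernel_eq_def)
qed

definition volterra_mat :: "star_dist^'n^'n \<Rightarrow> bool" where
  "volterra_mat A \<longleftrightarrow> (\<forall>k l. volterra_dist (A $ k $ l))"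

definition mat_eq :: "star_dist^'n^'n \<Rightarrow> star_dist^'n^'n \<Rightarrow> bool" where
  "mat_eq A B \<longleftrightarrow> (\<forall>k l. dist_eq (A $ k $ l) (B $ k $ l))"

lemma mat_eq_refl [simp]: "mat_eq A A"
  by (simp add: mat_eq_def)

lemma mat_eq_trans [trans]: "mat_eq A B \<Longrightarrow> mat_eq B C \<Longrightarrow> mat_eq A C"
  unfolding mat_eq_def using dist_eq_trans by blast

lemma mat_eq_mat_star: "mat_eq A A' \<Longrightarrow> mat_eq B B' \<Longrightarrow> mat_eq (mat_star A B) (mat_star A' B')"
  by (simp add: mat_eq_def mat_star_def dist_eq_sum dist_eq_star)

lemma volterra_mat_star: "volterra_mat A \<Longrightarrow> volterra_mat B \<Longrightarrow> volterra_mat (mat_star A B)"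
  by (simp add: volterra_mat_def mat_star_def volterra_dist_sum volterra_dist_star)

lemma mat_eq_mat_star_assoc:
  assumes "volterra_mat A" "volterra_mat B" "volterra_mat D"
  shows "mat_eq (mat_star (mat_star A B) D) (mat_star A (mat_star B D))"
proof -
  have v: "volterra_dist (A $ k $ l)" "volterra_dist (B $ k $ l)" "volterra_dist (D $ k $ l)" for k l
    using assms by (auto simp: volterra_mat_def)
  have "dist_eq (\<Sum>j\<in>UNIV. (\<Sum>i\<in>UNIV. A $ k $ i \<star> B $ i $ j) \<star> D $ j $ l)
      (\<Sum>i\<in>UNIV. A $ k $ i \<star> (\<Sum>j\<in>UNIV. B $ i $ j \<star> D $ j $ l))" for k l
  proof -
    have "dist_eq (\<Sum>j\<in>UNIV. (\<Sum>i\<in>UNIV. A $ k $ i \<star> B $ i $ j) \<star> D $ j $ l)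
        (\<Sum>j\<in>UNIV. \<Sum>i\<in>UNIV. A $ k $ i \<star> B $ i $ j \<star> D $ j $ l)"
      by (intro dist_eq_sum dist_eq_star_sum_left volterra_dist_star v)
    also have "dist_eq (\<Sum>j\<in>UNIV. \<Sum>i\<in>UNIV. A $ k $ i \<star> B $ i $ j \<star> D $ j $ l)
        (\<Sum>j\<in>UNIV. \<Sum>i\<in>UNIV. A $ k $ i \<star> (B $ i $ j \<star> D $ j $ l))"
      by (intro dist_eq_sum dist_eq_star_assoc v)
    also have "(\<Sum>j\<in>UNIV. \<Sum>i\<in>UNIV. A $ k $ i \<star> (B $ i $ j \<star> D $ j $ l)) =
        (\<Sum>i\<in>UNIV. \<Sum>j\<in>UNIV. A $ k $ i \<star> (B $ i $ j \<star> D $ j $ l))"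
      by (rule sum.swap)
    also have "dist_eq (\<Sum>i\<in>UNIV. \<Sum>j\<in>UNIV. A $ k $ i \<star> (B $ i $ j \<star> D $ j $ l))
        (\<Sum>i\<in>UNIV. A $ k $ i \<star> (\<Sum>j\<in>UNIV. B $ i $ j \<star> D $ j $ l))"
      by (intro dist_eq_sum dist_eq_sym[OF dist_eq_star_sum_right] volterra_dist_star v)
    finally show ?thesis .
  qed
  thus ?thesis by (simp add: mat_eq_def mat_star_def)
qed

lemma volterra_mat_star_power: "volterra_mat A \<Longrightarrow> volterra_mat (mat_star_power A m)"
proof (induction m)
  case 0
  show ?case by (simp add: volterra_mat_def)
next
  case (Suc m)
  thus ?case by (simp add: volterra_mat_star)
qed

lemma mat_star_one_left: "mat_star (mat_star_power A 0) B = B"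
  by (simp add: mat_star_def vec_eq_iff if_distribR if_distrib[of "\<lambda>x. x \<star> _"] cong: if_cong)

lemma mat_star_one_right: "mat_star B (mat_star_power A 0) = B"
  by (simp add: mat_star_def vec_eq_iff if_distrib[of "\<lambda>x. _ \<star> x"] cong: if_cong)

text \<open>Powers are defined by multiplication from the left; associativity allows one to multiply from the
right, as the other one-sided inverse requires.\<close>

lemma mat_star_power_commute:
  assumes A: "volterra_mat A"
  shows "mat_eq (mat_star (mat_star_power A m) A) (mat_star_power A (Suc m))"
proof (induction m)
  case 0
  show ?case by (simp only: mat_star_one_left mat_star_power.simps(2) mat_star_one_right mat_eq_refl)
next
  case (Suc m)
  have "mat_eq (mat_star (mat_star A (mat_star_power A m)) A)
      (mat_star A (mat_star (mat_star_power A m) A))"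
    by (intro mat_eq_mat_star_assoc A volterra_mat_star_power)
  also have "mat_eq \<dots> (mat_star A (mat_star_power A (Suc m)))"
    by (intro mat_eq_mat_star Suc.IH mat_eq_refl)
  finally show ?case by simp
qed

section \<open>Block matrices of products\<close>

lemma kernel_coeff_matrix_0 [simp]: "kernel_coeff_matrix (\<lambda>t s. 0) i j = 0"
  by (simp add: kernel_coeff_matrix_def)

lemma kernel_coeff_matrix_add:
  assumes "volterra f" "volterra g"
  shows "kernel_coeff_matrix (\<lambda>t s. f t s + g t s) i j =
         kernel_coeff_matrix f i j + kernel_coeff_matrix g i j"
proof -
  note vr = volterra_legendre_row[of i] and vc = volterra_legendre_col[of j]
  have "kernel_eq (kernel_star (\<lambda>t s. f t s + g t s) (legendre_col j))
      (\<lambda>t s. kernel_star f (legendre_col j) t s + kernel_star g (legendre_col j) t s)"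
    using assms vc by (simp add: kernel_eq_def kernel_star_add_left)
  from kernel_star_cong[OF _ this, of "legendre_row i" "legendre_row i"]
  show ?thesis
    using assms vr vc
    by (simp add: kernel_eq_def kernel_coeff_matrix_eq_kernel_star kernel_star_add_right
        volterra_kernel_star)
qed

lemma kernel_coeff_matrix_mult:
  "kernel_coeff_matrix (\<lambda>t s. c * f t s) i j = c * kernel_coeff_matrix f i j"
proof -
  have "kernel_star (\<lambda>t s. c * f t s) (legendre_col j) =
      (\<lambda>t s. c * kernel_star f (legendre_col j) t s)"
    by (intro ext kernel_star_mult_left)
  thus ?thesis by (simp add: kernel_coeff_matrix_eq_kernel_star kernel_star_mult_right)
qed

lemma coeff_matrix_cong: "dist_eq X Y \<Longrightarrow> coeff_matrix X = coeff_matrix Y"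
  using kernel_coeff_matrix_cong[of "kernel_part X" "kernel_part Y"]
  by (simp add: dist_eq_def coeff_matrix_def)

lemma coeff_matrix_sum:
  assumes "\<And>q. q \<in> I \<Longrightarrow> volterra_dist (X q)"
  shows "coeff_matrix (sum X I) i j = (\<Sum>q\<in>I. coeff_matrix (X q) i j)"
  using assms
proof (induction I rule: infinite_finite_induct)
  case (insert q I)
  have "kernel_coeff_matrix (kernel_part (X q + sum X I)) i j =
      kernel_coeff_matrix (kernel_part (X q)) i j + kernel_coeff_matrix (kernel_part (sum X I)) i j"
    using insert.prems volterra_dist_sum[of I X] by (simp add: kernel_coeff_matrix_add)
  thus ?case using insert by (simp add: coeff_matrix_def distrib_right)
qed (simp_all add: coeff_matrix_def)

text \<open>The Dirac parts contribute multiples of the identity matrix, whose products with another matrix are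
series with a single nonzero term; the kernel parts multiply by
\<open>kernel_coeff_matrix_star\<close>.\<close>

theorem coeff_matrix_star:
  assumes X: "volterra_dist X" and Y: "volterra_dist Y"
  shows "(\<lambda>m. coeff_matrix X i m * coeff_matrix Y m j) sums coeff_matrix (X \<star> Y) i j"
proof -
  define F G where "F = kernel_coeff_matrix (kernel_part X)"
    and "G = kernel_coeff_matrix (kernel_part Y)"
  define x y where "x = delta_coeff X" and "y = delta_coeff Y"
  have 1: "(\<lambda>m. if m = i then x * coeff_matrix Y m j else 0) sums (x * coeff_matrix Y i j)"
    by (rule sums_single)
  have 2: "(\<lambda>m. if m = j then y * F i m else 0) sums (y * F i j)"
    by (rule sums_single)
  have 3: "(\<lambda>m. F i m * G m j) sums kernel_coeff_matrix (kernel_star (kernel_part X) (kernel_part Y)) i j"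
    unfolding F_def G_def by (rule kernel_coeff_matrix_star[OF X Y])
  have "(\<lambda>m. (if m = i then x * coeff_matrix Y m j else 0) + (if m = j then y * F i m else 0)
      + F i m * G m j) = (\<lambda>m. coeff_matrix X i m * coeff_matrix Y m j)"
    by (auto simp: fun_eq_iff coeff_matrix_def inf_matrix_one_def x_def y_def F_def G_def algebra_simps)
  moreover have "x * coeff_matrix Y i j + y * F i j
      + kernel_coeff_matrix (kernel_star (kernel_part X) (kernel_part Y)) i j =
      coeff_matrix (X \<star> Y) i j"
    using X Y
    by (simp add: coeff_matrix_def kernel_part_star kernel_coeff_matrix_add kernel_coeff_matrix_mult
        volterra_add volterra_mult_left volterra_kernel_star x_def y_def F_def algebra_simps)
  ultimately show ?thesis using sums_add[OF sums_add[OF 1 2] 3] by simp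
qed

theorem is_block_product_mat_star:
  assumes "volterra_mat X" "volterra_mat Y"
  shows "is_block_product (block_matrix X) (block_matrix Y) (block_matrix (mat_star X Y))"
proof -
  have v: "volterra_dist (X $ k $ l)" "volterra_dist (Y $ k $ l)" for k l
    using assms by (auto simp: volterra_mat_def)
  have s: "(\<lambda>m. coeff_matrix (X $ k $ q) i m * coeff_matrix (Y $ q $ l) m j) sums
      coeff_matrix (X $ k $ q \<star> Y $ q $ l) i j" for k q l i j
    by (rule coeff_matrix_star[OF v])
  have "block_mult (block_matrix X) (block_matrix Y) = block_matrix (mat_star X Y)"
    by (simp add: block_mult_def block_matrix_def mat_star_def vec_eq_iff fun_eq_iff
        sums_unique[OF s, symmetric] coeff_matrix_sum volterra_dist_star v)
  thus ?thesis
    using sums_summable[OF s] by (auto simp: is_block_product_def block_matrix_def)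
qed

lemma block_matrix_cong: "mat_eq X Y \<Longrightarrow> block_matrix X = block_matrix Y"
  by (simp add: mat_eq_def block_matrix_def vec_eq_iff coeff_matrix_cong)

lemma block_matrix_one: "block_matrix (mat_star_power A 0) = block_one"
  by (auto simp: block_matrix_def block_one_def vec_eq_iff coeff_matrix_def fun_eq_iff)

definition one_plus :: "star_dist^'n^'n \<Rightarrow> star_dist^'n^'n" where
  "one_plus A = (\<chi> k l. (if k = l then star_one else 0) + A $ k $ l)"

abbreviation neg_one :: star_dist where
  "neg_one \<equiv> StarDist (-1) (\<lambda>t s. 0)"

definition one_minus :: "star_dist^'n^'n \<Rightarrow> star_dist^'n^'n" where
  "one_minus A = (\<chi> k l. (if k = l then star_one else 0) + neg_one \<star> A $ k $ l)"

lemma block_matrix_one_plus: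
  "block_matrix (one_plus A) = block_add block_one (block_matrix A)"
  by (auto simp: block_matrix_def block_one_def block_add_def one_plus_def vec_eq_iff
      coeff_matrix_def fun_eq_iff algebra_simps)

lemma block_matrix_one_minus:
  "block_matrix (one_minus A) = block_diff block_one (block_matrix A)"
  using kernel_coeff_matrix_mult[of "-1"]
  by (auto simp: block_matrix_def block_one_def block_diff_def one_minus_def vec_eq_iff
      coeff_matrix_def fun_eq_iff kernel_part_star algebra_simps)

section \<open>Geometric decay of the powers\<close>

text \<open>Once \<open>d p < 1/2\<close> for some \<open>p > 0\<close>, every block of \<open>p\<close> indices halves the value, so \<open>q\<close> is the
\<open>p\<close>-th root of \<open>1/2\<close>; the constant \<open>K\<close> covers the first block.\<close>

lemma submultiplicative_geometric_decay:
  fixes d :: "nat \<Rightarrow> real"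
  assumes nonneg: "\<And>j. d j \<ge> 0" and sub: "\<And>i j. d (i + j) \<le> d i * d j"
    and lim: "d \<longlonglongrightarrow> 0"
  obtains K q where "K > 0" "0 < q" "q < 1" "\<And>j. d j \<le> K * q ^ j"
proof -
  have "eventually (\<lambda>j. d j < 1 / 2) sequentially"
    by (rule order_tendstoD(2)[OF lim]) simp
  hence "eventually (\<lambda>j. d j < 1 / 2 \<and> j > 0) sequentially"
    using eventually_gt_at_top by (rule eventually_conj)
  then obtain p where p: "d p < 1 / 2" "p > 0"
    using eventually_happens'[OF sequentially_bot] by blast
  define q where "q = root p (1 / 2)"
  have q: "0 < q" "q < 1" "q ^ p = 1 / 2"
    using p(2) by (auto simp: q_def)
  define K where "K = 1 + (\<Sum>b<p. d b / q ^ b)"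
  have K: "K > 0"
    unfolding K_def using nonneg q by (intro add_pos_nonneg sum_nonneg) auto
  have "d j \<le> K * q ^ j" for j
  proof (induction j rule: less_induct)
    case (less j)
    show ?case
    proof (cases "j < p")
      case True
      have "d j / q ^ j \<le> (\<Sum>b<p. d b / q ^ b)"
        using True nonneg q by (intro member_le_sum) auto
      hence "d j / q ^ j \<le> K" by (simp add: K_def)
      thus ?thesis using q by (simp add: field_simps)
    next
      case False
      hence j: "j = p + (j - p)" by simp
      have "d j \<le> d p * d (j - p)" using sub[of p "j - p"] j by simp
      also have "\<dots> \<le> 1 / 2 * (K * q ^ (j - p))"
        using p less.IH[of "j - p"] False nonneg by (intro mult_mono) auto
      also have "\<dots> = K * q ^ (p + (j - p))"
        by (simp add: power_add q(3))
      finally show ?thesis using j by simp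
    qed
  qed
  thus thesis using K q that by blast
qed

text \<open>A submultiplicative norm that dominates every entry.\<close>

definition l1 :: "complex^'n^'n \<Rightarrow> real" where
  "l1 X = (\<Sum>k\<in>UNIV. \<Sum>l\<in>UNIV. norm (X $ k $ l))"

lemma l1_nonneg: "l1 X \<ge> 0"
  by (simp add: l1_def sum_nonneg)

lemma norm_entry_le_l1: "norm (X $ k $ l) \<le> l1 X"
proof -
  have "norm (X $ k $ l) \<le> (\<Sum>l\<in>UNIV. norm (X $ k $ l))"
    by (rule member_le_sum) auto
  also have "\<dots> \<le> l1 X"
    unfolding l1_def by (rule member_le_sum) (auto intro: sum_nonneg)
  finally show ?thesis .
qed

lemma l1_add: "l1 (X + Y) \<le> l1 X + l1 Y"
  unfolding l1_def sum.distrib[symmetric] by (intro sum_mono) (simp add: norm_triangle_ineq)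

lemma l1_mult: "l1 (X ** Y) \<le> l1 X * l1 Y"
proof -
  have "l1 (X ** Y) \<le> (\<Sum>k\<in>UNIV. \<Sum>l\<in>UNIV. \<Sum>p\<in>UNIV. norm (X $ k $ p) * norm (Y $ p $ l))"
    unfolding l1_def matrix_matrix_mult_def
    by (intro sum_mono) (auto intro!: order_trans[OF norm_sum] simp: norm_mult)
  also have "\<dots> = (\<Sum>k\<in>UNIV. \<Sum>p\<in>UNIV. norm (X $ k $ p) * (\<Sum>l\<in>UNIV. norm (Y $ p $ l)))"
    by (subst sum.swap) (simp add: sum_distrib_left)
  also have "\<dots> \<le> (\<Sum>k\<in>UNIV. \<Sum>p\<in>UNIV. norm (X $ k $ p) * l1 Y)"
  proof (intro sum_mono mult_left_mono)
    show "(\<Sum>l\<in>UNIV. norm (Y $ p $ l)) \<le> l1 Y" for p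
      unfolding l1_def by (rule member_le_sum) (auto intro: sum_nonneg)
  qed simp
  also have "\<dots> = l1 X * l1 Y" by (simp add: l1_def sum_distrib_right)
  finally show ?thesis .
qed

lemma l1_le:
  fixes X :: "complex^'n^'n"
  assumes "\<And>k l. norm (X $ k $ l) \<le> b"
  shows "l1 X \<le> (real CARD('n))\<^sup>2 * b"
proof -
  have "l1 X \<le> (\<Sum>k\<in>(UNIV :: 'n set). \<Sum>l\<in>(UNIV :: 'n set). b)"
    unfolding l1_def by (intro sum_mono assms)
  thus ?thesis by (simp add: power2_eq_square)
qed

abbreviation delta_power :: "star_dist^'n^'n \<Rightarrow> nat \<Rightarrow> complex^'n^'n" where
  "delta_power A m \<equiv> (\<chi> k l. delta_coeff (mat_star_power A m $ k $ l))"

abbreviation kernel_mat :: "star_dist^'n^'n \<Rightarrow> real \<Rightarrow> real \<Rightarrow> complex^'n^'n" where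
  "kernel_mat A t s \<equiv> (\<chi> k l. kernel_part (A $ k $ l) t s)"

lemma kernel_part_mat_star_power_0 [simp]:
  "kernel_part (mat_star_power A 0 $ k $ l) = (\<lambda>t s. 0)"
  by simp

lemma kernel_part_one_plus [simp]:
  "kernel_part (one_plus A $ k $ l) = kernel_part (A $ k $ l)"
  by (simp add: one_plus_def)

lemma delta_power_0: "delta_power A 0 = mat 1"
  by (auto simp: mat_def vec_eq_iff)

lemma delta_power_add: "delta_power A (i + j) = delta_power A i ** delta_power A j"
proof -
  define a where "a = (\<chi> k l. delta_coeff (A $ k $ l))"
  have step: "delta_power A (Suc m) = a ** delta_power A m" for m
    by (simp add: a_def vec_eq_iff mat_star_def star_dist_sum matrix_matrix_mult_def)
  show ?thesis
  proof (induction i)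
    case 0
    show ?case unfolding delta_power_0 by simp
  next
    case (Suc i)
    thus ?case using step[of "i + j"] step[of i] unfolding add_Suc by (simp only: matrix_mul_assoc)
  qed
qed

text \<open>Convergence of the entries of the series makes the powers of the Dirac coefficient matrix tend to zero,
and submultiplicativity improves this to a geometric rate.\<close>

lemma delta_power_geometric_decay:
  fixes A :: "star_dist^'n^'n"
  assumes "\<And>k l. summable (\<lambda>m. delta_coeff (mat_star_power A (Suc m) $ k $ l))"
  obtains K q where "K > 0" "0 < q" "q < 1" "\<And>j. l1 (delta_power A j) \<le> K * q ^ j"
proof (rule submultiplicative_geometric_decay[of "\<lambda>j. l1 (delta_power A j)"])
  show "l1 (delta_power A (i + j)) \<le> l1 (delta_power A i) * l1 (delta_power A j)" for i j
    unfolding delta_power_add by (rule l1_mult)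
  have "(\<lambda>m. delta_coeff (mat_star_power A m $ k $ l)) \<longlonglongrightarrow> 0" for k l
    by (rule LIMSEQ_imp_Suc) (rule summable_LIMSEQ_zero[OF assms])
  hence "(\<lambda>j. \<Sum>k\<in>UNIV. \<Sum>l\<in>UNIV. norm (delta_coeff (mat_star_power A j $ k $ l)))
      \<longlonglongrightarrow> (\<Sum>k\<in>(UNIV :: 'n set). \<Sum>l\<in>(UNIV :: 'n set). 0)"
    by (intro tendsto_sum tendsto_norm_zero)
  thus "(\<lambda>j. l1 (delta_power A j)) \<longlonglongrightarrow> 0" by (simp add: l1_def)
qed (auto intro: l1_nonneg)

lemma kernel_mat_mat_star:
  "kernel_mat (mat_star A B) t s =
     (\<chi> k l. delta_coeff (A $ k $ l)) ** kernel_mat B t s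
     + kernel_mat A t s ** (\<chi> k l. delta_coeff (B $ k $ l))
     + (\<chi> k l. \<Sum>p\<in>UNIV. kernel_star (kernel_part (A $ k $ p)) (kernel_part (B $ p $ l)) t s)"
  by (simp add: vec_eq_iff mat_star_def star_dist_sum kernel_part_star matrix_matrix_mult_def
      sum.distrib mult.commute)

lemma volterra_mat_bounded:
  assumes "volterra_mat A"
  obtains M where "M > 0" "\<And>t s. t \<in> unit_ivl \<Longrightarrow> s \<in> unit_ivl \<Longrightarrow> l1 (kernel_mat A t s) \<le> M"
proof -
  have "\<exists>M. \<forall>t\<in>unit_ivl. \<forall>s\<in>unit_ivl. norm (kernel_part (A $ k $ l) t s) \<le> M" for k l
    using volterra_bounded[of "kernel_part (A $ k $ l)"] assms unfolding volterra_mat_def by metis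
  then obtain M where M: "\<And>k l t s. t \<in> unit_ivl \<Longrightarrow> s \<in> unit_ivl \<Longrightarrow>
      norm (kernel_part (A $ k $ l) t s) \<le> M k l" by metis
  have "l1 (kernel_mat A t s) \<le> max 1 (\<Sum>k\<in>UNIV. \<Sum>l\<in>UNIV. M k l)"
    if "t \<in> unit_ivl" "s \<in> unit_ivl" for t s
    unfolding l1_def using M[OF that] by (intro max.coboundedI2 sum_mono) simp
  thus thesis by (rule that[rotated]) auto
qed

text \<open>Write \<open>A = a \<delta> + f\<close> and let \<open>G\<^sub>m\<close> be the kernel part of the \<open>m\<close>-th power, so that
\<open>G\<^sub>m\<^sub>+\<^sub>1 = a G\<^sub>m + f a\<^sup>m + f \<star> G\<^sub>m\<close>. The powers of \<open>a\<close> decay like \<open>q\<^sup>m\<close>, but a single factor \<open>a\<close> may have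
norm larger than \<open>1\<close>. Therefore the induction on \<open>m\<close> bounds \<open>a\<^sup>j G\<^sub>m\<close> for all \<open>j\<close> at once, by
\<open>L q\<^sup>j r\<^sup>m exp (L (t - s))\<close> with any \<open>r\<close> between \<open>q\<close> and \<open>1\<close>: the first term of the recursion is
absorbed by raising \<open>j\<close>, and the last one is small because of the exponential weight.\<close>

theorem kernel_mat_power_geometric_decay:
  fixes A :: "star_dist^'n^'n"
  assumes A: "volterra_mat A"
    and sum: "\<And>k l. summable (\<lambda>m. delta_coeff (mat_star_power A (Suc m) $ k $ l))"
  obtains L r where "0 < r" "r < 1"
    "\<And>m k l t s. t \<in> unit_ivl \<Longrightarrow> s \<in> unit_ivl \<Longrightarrow>
       norm (kernel_part (mat_star_power A m $ k $ l) t s) \<le> L * r ^ m"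
proof -
  obtain K q where K: "K > 0" and q: "0 < q" "q < 1"
    and Kq: "\<And>j. l1 (delta_power A j) \<le> K * q ^ j"
    using delta_power_geometric_decay[OF sum] by blast
  obtain M where M: "M > 0"
    "\<And>t s. t \<in> unit_ivl \<Longrightarrow> s \<in> unit_ivl \<Longrightarrow> l1 (kernel_mat A t s) \<le> M"
    using volterra_mat_bounded[OF A] by blast
  define N where "N = real CARD('n)"
  have N: "N > 0" by (simp add: N_def)
  define r where "r = (q + 1) / 2"
  have r: "q < r" "r < 1" "0 < r" using q by (auto simp: r_def)
  \<comment> \<open>The sum of two terms is chosen so that \<open>c\<close> dominates both constants in \<open>c1\<close> and \<open>c2\<close>.\<close>
  define c where "c = (K + N ^ 3) * K * M"
  have c: "c > 0" using K M N by (simp add: c_def add_pos_pos)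
  have c1: "K * M * K \<le> c" and c2: "K * N ^ 3 * M \<le> c"
    using K M N by (simp_all add: c_def algebra_simps)
  \<comment> \<open>\<open>L\<close> is at once the constant in front and the rate of the exponential weight, so that in the estimate
    of \<open>f \<star> G\<^sub>m\<close> it cancels. The induction step then closes because \<open>L q + c + c = L r\<close>.\<close>
  define L where "L = 2 * c / (r - q)"
  have L: "L > 0" "L * r = L * q + 2 * c"
    using c r by (auto simp: L_def field_simps)
  let ?D = "delta_power A" and ?G = "\<lambda>m. kernel_mat (mat_star_power A m)"
  have vol: "volterra_dist (mat_star_power A m $ k $ l)" "volterra_dist (A $ k $ l)" for m k l
    using volterra_mat_star_power[OF A] A by (auto simp: volterra_mat_def)
  have claim: "l1 (?D j ** ?G m t s) \<le> L * q ^ j * r ^ m * exp (L * (t - s))"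
    if "0 \<le> s" "s \<le> t" "t \<le> 1" for j m t s
    using that
  proof (induction m arbitrary: j t s)
    case 0
    have "?D j ** ?G 0 t s = 0"
      by (simp add: vec_eq_iff matrix_matrix_mult_def del: mat_star_power.simps)
    thus ?case using L q r by (simp add: l1_def)
  next
    case (Suc m)
    define E where "E = exp (L * (t - s))"
    have E: "E \<ge> 1" using L Suc.prems by (simp add: E_def)
    have ts: "t \<in> unit_ivl" "s \<in> unit_ivl" using Suc.prems by auto
    define H :: "complex^'n^'n" where "H = (\<chi> k l. \<Sum>p\<in>UNIV.
        kernel_star (kernel_part (A $ k $ p)) (kernel_part (mat_star_power A m $ p $ l)) t s)"
    have D1: "(\<chi> k l. delta_coeff (A $ k $ l)) = ?D 1"
      using mat_star_one_right[of A] by (simp add: One_nat_def del: mat_star_power.simps(1))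
    have "?G (Suc m) t s = ?D 1 ** ?G m t s + kernel_mat A t s ** ?D m + H"
      unfolding mat_star_power.simps(2) kernel_mat_mat_star D1 H_def ..
    hence "?D j ** ?G (Suc m) t s =
        ?D j ** ?D 1 ** ?G m t s + ?D j ** kernel_mat A t s ** ?D m + ?D j ** H"
      by (simp only: matrix_add_ldistrib matrix_mul_assoc)
    also have "?D j ** ?D 1 = ?D (Suc j)"
      using delta_power_add[of A j 1] by simp
    finally have eq: "?D j ** ?G (Suc m) t s =
        ?D (Suc j) ** ?G m t s + ?D j ** kernel_mat A t s ** ?D m + ?D j ** H" .
    have b1: "l1 (?D (Suc j) ** ?G m t s) \<le> L * q * (q ^ j * r ^ m * E)"
      using Suc.IH[OF Suc.prems, of "Suc j"] by (simp add: E_def mult_ac)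
    have b2: "l1 (?D j ** kernel_mat A t s ** ?D m) \<le> c * (q ^ j * r ^ m * E)"
    proof -
      have "l1 (?D j ** kernel_mat A t s ** ?D m) \<le>
          l1 (?D j) * l1 (kernel_mat A t s) * l1 (?D m)"
        by (intro order_trans[OF l1_mult] mult_right_mono l1_mult l1_nonneg)
      also have "\<dots> \<le> (K * q ^ j) * M * (K * q ^ m)"
        using Kq M(2)[OF ts] l1_nonneg K q M(1)
        by (intro mult_mono) (auto intro!: mult_nonneg_nonneg)
      also have "\<dots> = (K * M * K) * (q ^ j * (q ^ m * 1))" by simp
      also have "\<dots> \<le> c * (q ^ j * (r ^ m * E))"
        using c1 c q r E by (intro mult_mono power_mono) auto
      finally show ?thesis by (simp add: mult_ac)
    qed
    have b3: "l1 (?D j ** H) \<le> c * (q ^ j * r ^ m * E)"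
    proof -
      have "norm (kernel_star (kernel_part (A $ k $ p)) (kernel_part (mat_star_power A m $ p $ l)) t s)
          \<le> M * r ^ m * E" for k p l
      proof -
        have "norm (kernel_star (kernel_part (A $ k $ p)) (kernel_part (mat_star_power A m $ p $ l)) t s)
            \<le> M * (L * r ^ m) / L * exp (L * (t - s))"
        proof (rule norm_kernel_star_le[OF vol(2) vol(1) ts Suc.prems(2) L(1)])
          fix \<tau> assume \<tau>: "\<tau> \<in> {s..t}"
          show "norm (kernel_part (A $ k $ p) t \<tau>) \<le> M"
            using norm_entry_le_l1[of "kernel_mat A t \<tau>" k p] M(2)[of t \<tau>] \<tau> ts by simp
          have "norm (kernel_part (mat_star_power A m $ p $ l) \<tau> s) \<le> l1 (?D 0 ** ?G m \<tau> s)"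
            using norm_entry_le_l1[of "?G m \<tau> s" p l] unfolding delta_power_0 by simp
          also have "\<dots> \<le> L * r ^ m * exp (L * (\<tau> - s))"
            using Suc.IH[of s \<tau> 0] \<tau> ts by simp
          finally show "norm (kernel_part (mat_star_power A m $ p $ l) \<tau> s)
              \<le> L * r ^ m * exp (L * (\<tau> - s))" .
        qed
        thus ?thesis using L(1) by (simp add: E_def)
      qed
      hence "norm (H $ k $ l) \<le> (\<Sum>p\<in>(UNIV :: 'n set). M * r ^ m * E)" for k l
        unfolding H_def by (simp del: sum_constant) (intro sum_norm_le)
      hence "l1 H \<le> N\<^sup>2 * (N * (M * r ^ m * E))"
        unfolding N_def by (intro l1_le) simp
      hence "l1 (?D j ** H) \<le> (K * q ^ j) * (N\<^sup>2 * (N * (M * r ^ m * E)))"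
        using Kq K q l1_nonneg by (intro order_trans[OF l1_mult] mult_mono) auto
      also have "\<dots> = (K * N ^ 3 * M) * (q ^ j * r ^ m * E)"
        by (simp add: power2_eq_square power3_eq_cube)
      also have "\<dots> \<le> c * (q ^ j * r ^ m * E)"
        using c2 q r E by (intro mult_right_mono) auto
      finally show ?thesis .
    qed
    have "l1 (?D j ** ?G (Suc m) t s) \<le>
        l1 (?D (Suc j) ** ?G m t s) + l1 (?D j ** kernel_mat A t s ** ?D m) + l1 (?D j ** H)"
      unfolding eq by (intro order_trans[OF l1_add] add_right_mono l1_add)
    also have "\<dots> \<le> (L * q + 2 * c) * (q ^ j * r ^ m * E)"
      using b1 b2 b3 by (simp add: distrib_right)
    also have "\<dots> = L * q ^ j * r ^ Suc m * E"
      unfolding L(2)[symmetric] by simp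
    finally show ?case by (simp only: E_def)
  qed
  have "norm (kernel_part (mat_star_power A m $ k $ l) t s) \<le> L * exp L * r ^ m"
    if ts: "t \<in> unit_ivl" "s \<in> unit_ivl" for m k l t s
  proof (cases "s \<le> t")
    case True
    have "norm (kernel_part (mat_star_power A m $ k $ l) t s) \<le> l1 (?D 0 ** ?G m t s)"
      using norm_entry_le_l1[of "?G m t s" k l] unfolding delta_power_0 by simp
    also have "\<dots> \<le> L * r ^ m * exp (L * (t - s))"
      using claim[of s t 0 m] True ts by simp
    also have "\<dots> \<le> L * r ^ m * exp L"
      using L r ts mult_left_mono[of "t - s" 1 L] by (intro mult_left_mono) auto
    finally show ?thesis by (simp add: mult_ac)
  next
    case False
    thus ?thesis using volterra_zero[OF vol(1) ts] L r by simp
  qed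
  thus thesis by (rule that[OF r(3,2)])
qed

section \<open>The Neumann series\<close>

lemma kernel_part_star_sums_right:
  assumes "volterra_dist Y" "(\<lambda>m. delta_coeff (X m)) sums delta_coeff Z"
    "kernel_sums (\<lambda>m. kernel_part (X m)) (kernel_part Z)" "t \<in> unit_ivl" "s \<in> unit_ivl"
  shows "(\<lambda>m. kernel_part (Y \<star> X m) t s) sums kernel_part (Y \<star> Z) t s"
  unfolding kernel_part_star
  using assms
  by (intro sums_add sums_mult sums_mult2 kernel_star_sums_right) (auto simp: kernel_sums_def)

lemma kernel_part_star_sums_left:
  assumes "volterra_dist Y" "(\<lambda>m. delta_coeff (X m)) sums delta_coeff Z"
    "kernel_sums (\<lambda>m. kernel_part (X m)) (kernel_part Z)" "t \<in> unit_ivl" "s \<in> unit_ivl"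
  shows "(\<lambda>m. kernel_part (X m \<star> Y) t s) sums kernel_part (Z \<star> Y) t s"
  unfolding kernel_part_star
  using assms
  by (intro sums_add sums_mult sums_mult2 kernel_star_sums_left) (auto simp: kernel_sums_def)

text \<open>The zeroth power has kernel part \<open>0\<close>, so it may be included in the series: the sum runs over the
same index as the powers, which makes multiplication by \<open>A\<close> an index shift.\<close>

lemma kernel_sums_mat_star_power:
  assumes A: "volterra_mat A"
    and sum: "\<And>k l. summable (\<lambda>m. delta_coeff (mat_star_power A (Suc m) $ k $ l))"
  shows "kernel_sums (\<lambda>m. kernel_part (mat_star_power A m $ k $ l))
           (kernel_part (star_series A $ k $ l))"
proof -
  obtain L r where r: "0 < r" "r < 1" and L: "\<And>m t s. t \<in> unit_ivl \<Longrightarrow> s \<in> unit_ivl \<Longrightarrow>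
       norm (kernel_part (mat_star_power A m $ k $ l) t s) \<le> L * r ^ m"
    using kernel_mat_power_geometric_decay[OF A sum] by metis
  have B: "summable (\<lambda>m. L * r ^ m)"
    using r by (intro summable_mult summable_geometric) auto
  have "(\<lambda>m. kernel_part (mat_star_power A m $ k $ l) t s) sums
      kernel_part (star_series A $ k $ l) t s" if ts: "t \<in> unit_ivl" "s \<in> unit_ivl" for t s
  proof -
    have 0: "kernel_part (mat_star_power A 0 $ k $ l) t s = 0" by simp
    have "summable (\<lambda>m. kernel_part (mat_star_power A m $ k $ l) t s)"
      using B L[OF ts] by (rule summable_comparison_test')
    hence "summable (\<lambda>m. kernel_part (mat_star_power A (Suc m) $ k $ l) t s)"
      by (subst summable_Suc_iff)
    from sums_Suc[OF summable_sums[OF this]] show ?thesis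
      unfolding 0 by (simp add: star_series_def del: mat_star_power.simps)
  qed
  thus ?thesis
    using B L volterra_mat_star_power[OF A] unfolding kernel_sums_def volterra_mat_def by blast
qed

lemma delta_sums_one_plus_star_series:
  assumes "summable (\<lambda>m. delta_coeff (mat_star_power A (Suc m) $ k $ l))"
  shows "(\<lambda>m. delta_coeff (mat_star_power A m $ k $ l)) sums
           delta_coeff (one_plus (star_series A) $ k $ l)"
  using sums_Suc[OF summable_sums[OF assms]]
  by (simp add: star_series_def one_plus_def add.commute del: mat_star_power.simps(2))

lemma star_series_sums_star_series:
  assumes A: "volterra_mat A"
    and sum: "\<And>k l. summable (\<lambda>m. delta_coeff (mat_star_power A (Suc m) $ k $ l))"
  shows "star_series_sums A (star_series A)"
proof -
  have "(\<lambda>m. kernel_part (mat_star_power A (Suc m) $ k $ l) t s) sums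
      kernel_part (star_series A $ k $ l) t s" if "t \<in> unit_ivl" "s \<in> unit_ivl" for k l t s
  proof -
    have "(\<lambda>m. kernel_part (mat_star_power A m $ k $ l) t s) sums
      kernel_part (star_series A $ k $ l) t s"
      using kernel_sums_mat_star_power[OF A sum] that by (simp add: kernel_sums_def)
    thus ?thesis by (subst sums_Suc_iff) (simp del: mat_star_power.simps)
  qed
  thus ?thesis
    using summable_sums[OF sum] by (simp add: star_series_sums_def star_series_def)
qed

text \<open>Multiplying the series of all powers, whose sum is \<open>1 + C\<close>, termwise by \<open>A\<close> from either side gives
the series of all powers but the zeroth, whose sum is \<open>C\<close>.\<close>

theorem
  assumes A: "volterra_mat A"
    and sum: "\<And>k l. summable (\<lambda>m. delta_coeff (mat_star_power A (Suc m) $ k $ l))"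
  shows mat_star_one_plus_series_left:
      "mat_eq (mat_star A (one_plus (star_series A))) (star_series A)"
    and mat_star_one_plus_series_right:
      "mat_eq (mat_star (one_plus (star_series A)) A) (star_series A)"
proof -
  let ?U = "one_plus (star_series A)" and ?P = "mat_star_power A"
  have d: "(\<lambda>m. delta_coeff (?P m $ k $ l)) sums delta_coeff (?U $ k $ l)" for k l
    by (rule delta_sums_one_plus_star_series[OF sum])
  have k: "kernel_sums (\<lambda>m. kernel_part (?P m $ k $ l)) (kernel_part (?U $ k $ l))" for k l
    using kernel_sums_mat_star_power[OF A sum, of k l] by simp
  have v: "volterra_dist (A $ k $ l)" for k l using A by (simp add: volterra_mat_def)
  have S: "star_series_sums A (star_series A)" by (rule star_series_sums_star_series[OF A sum])
  have Sd: "(\<lambda>m. delta_coeff (?P (Suc m) $ k $ l)) sums delta_coeff (star_series A $ k $ l)"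
    and Sk: "\<And>t s. t \<in> unit_ivl \<Longrightarrow> s \<in> unit_ivl \<Longrightarrow>
      (\<lambda>m. kernel_part (?P (Suc m) $ k $ l) t s) sums kernel_part (star_series A $ k $ l) t s" for k l
    using S unfolding star_series_sums_def by blast+
  have comm: "delta_coeff (mat_star (?P m) A $ k $ l) = delta_coeff (?P (Suc m) $ k $ l)"
      "t \<in> unit_ivl \<Longrightarrow> s \<in> unit_ivl \<Longrightarrow>
       kernel_part (mat_star (?P m) A $ k $ l) t s = kernel_part (?P (Suc m) $ k $ l) t s" for m k l t s
    using mat_star_power_commute[OF A, of m] unfolding mat_eq_def dist_eq_def kernel_eq_def by blast+
  have "(\<lambda>m. delta_coeff (mat_star A (?P m) $ k $ l)) sums delta_coeff (mat_star A ?U $ k $ l)" for k l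
    unfolding mat_star_def by (simp add: star_dist_sum) (intro sums_sum sums_mult d)
  moreover have "(\<lambda>m. kernel_part (mat_star A (?P m) $ k $ l) t s) sums
      kernel_part (mat_star A ?U $ k $ l) t s" if "t \<in> unit_ivl" "s \<in> unit_ivl" for k l t s
    unfolding mat_star_def
    by (simp add: star_dist_sum) (intro sums_sum kernel_part_star_sums_right d k v that)
  ultimately show "mat_eq (mat_star A ?U) (star_series A)"
    using sums_unique2[OF _ Sd] sums_unique2[OF _ Sk]
    by (simp add: mat_eq_def dist_eq_def kernel_eq_def)
  have "(\<lambda>m. delta_coeff (mat_star (?P m) A $ k $ l)) sums delta_coeff (mat_star ?U A $ k $ l)" for k l
    unfolding mat_star_def by (simp add: star_dist_sum) (intro sums_sum sums_mult2 d)
  moreover have "(\<lambda>m. kernel_part (mat_star (?P m) A $ k $ l) t s) sums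
      kernel_part (mat_star ?U A $ k $ l) t s" if "t \<in> unit_ivl" "s \<in> unit_ivl" for k l t s
    unfolding mat_star_def
    by (simp add: star_dist_sum) (intro sums_sum kernel_part_star_sums_left d k v that)
  ultimately show "mat_eq (mat_star ?U A) (star_series A)"
    using sums_unique2[OF _ Sd] sums_unique2[OF _ Sk]
    by (simp add: mat_eq_def dist_eq_def kernel_eq_def comm)
qed


lemma dist_eq_neg_one_star:
  shows "dist_eq (neg_one \<star> X \<star> Y) (neg_one \<star> (X \<star> Y))"
    and "dist_eq (X \<star> (neg_one \<star> Y)) (neg_one \<star> (X \<star> Y))"
  using kernel_star_mult_left[of "-1"] kernel_star_mult_right[of _ "-1"]
  by (simp_all add: dist_eq_def kernel_eq_def kernel_part_star)

lemma volterra_one_minus: "volterra_mat A \<Longrightarrow> volterra_mat (one_minus A)"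
  by (auto simp: volterra_mat_def one_minus_def intro!: volterra_add volterra_dist_star)

lemma volterra_one_plus: "volterra_mat A \<Longrightarrow> volterra_mat (one_plus A)"
  by (simp add: volterra_mat_def)

text \<open>This is \<open>(1 - A) \<star> B = B - A \<star> B\<close>, with the minus sign written as a left factor
\<open>neg_one\<close>.\<close>

lemma mat_star_one_minus_left:
  assumes A: "volterra_mat A" and B: "volterra_mat B"
  shows "mat_eq (mat_star (one_minus A) B) (\<chi> k l. B $ k $ l + neg_one \<star> mat_star A B $ k $ l)"
proof -
  have v: "volterra_dist (A $ k $ l)" "volterra_dist (B $ k $ l)" "volterra_dist neg_one"
    "volterra_dist (if k = l then star_one else 0)" for k l
    using A B by (auto simp: volterra_mat_def)
  have "dist_eq (\<Sum>j\<in>UNIV. ((if k = j then star_one else 0) + neg_one \<star> A $ k $ j) \<star> B $ j $ l)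
      (B $ k $ l + neg_one \<star> (\<Sum>j\<in>UNIV. A $ k $ j \<star> B $ j $ l))" for k l
  proof -
    have "dist_eq (\<Sum>j\<in>UNIV. ((if k = j then star_one else 0) + neg_one \<star> A $ k $ j) \<star> B $ j $ l)
        (\<Sum>j\<in>UNIV. (if k = j then star_one else 0) \<star> B $ j $ l + neg_one \<star> A $ k $ j \<star> B $ j $ l)"
      by (intro dist_eq_sum dist_eq_star_add_left volterra_dist_star v)
    also have "dist_eq \<dots>
        (\<Sum>j\<in>UNIV. (if k = j then star_one else 0) \<star> B $ j $ l + neg_one \<star> (A $ k $ j \<star> B $ j $ l))"
      by (intro dist_eq_sum dist_eq_add dist_eq_neg_one_star dist_eq_refl)
    also have "\<dots> = mat_star (mat_star_power A 0) B $ k $ l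
        + (\<Sum>j\<in>UNIV. neg_one \<star> (A $ k $ j \<star> B $ j $ l))"
      by (simp add: mat_star_def sum.distrib)
    also have "dist_eq \<dots> (B $ k $ l + neg_one \<star> (\<Sum>j\<in>UNIV. A $ k $ j \<star> B $ j $ l))"
      unfolding mat_star_one_left
      by (intro dist_eq_add dist_eq_refl dist_eq_sym[OF dist_eq_star_sum_right] volterra_dist_star v)
    finally show ?thesis .
  qed
  thus ?thesis by (simp add: mat_eq_def mat_star_def one_minus_def)
qed

lemma mat_star_one_minus_right:
  assumes A: "volterra_mat A" and B: "volterra_mat B"
  shows "mat_eq (mat_star B (one_minus A)) (\<chi> k l. B $ k $ l + neg_one \<star> mat_star B A $ k $ l)"
proof -
  have v: "volterra_dist (A $ k $ l)" "volterra_dist (B $ k $ l)" "volterra_dist neg_one"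
    "volterra_dist (if k = l then star_one else 0)" for k l
    using A B by (auto simp: volterra_mat_def)
  have "dist_eq (\<Sum>j\<in>UNIV. B $ k $ j \<star> ((if j = l then star_one else 0) + neg_one \<star> A $ j $ l))
      (B $ k $ l + neg_one \<star> (\<Sum>j\<in>UNIV. B $ k $ j \<star> A $ j $ l))" for k l
  proof -
    have "dist_eq (\<Sum>j\<in>UNIV. B $ k $ j \<star> ((if j = l then star_one else 0) + neg_one \<star> A $ j $ l))
        (\<Sum>j\<in>UNIV. B $ k $ j \<star> (if j = l then star_one else 0) + B $ k $ j \<star> (neg_one \<star> A $ j $ l))"
      by (intro dist_eq_sum dist_eq_star_add_right volterra_dist_star v)
    also have "dist_eq \<dots>
        (\<Sum>j\<in>UNIV. B $ k $ j \<star> (if j = l then star_one else 0) + neg_one \<star> (B $ k $ j \<star> A $ j $ l))"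
      by (intro dist_eq_sum dist_eq_add dist_eq_neg_one_star dist_eq_refl)
    also have "\<dots> = mat_star B (mat_star_power A 0) $ k $ l
        + (\<Sum>j\<in>UNIV. neg_one \<star> (B $ k $ j \<star> A $ j $ l))"
      by (simp add: mat_star_def sum.distrib)
    also have "dist_eq \<dots> (B $ k $ l + neg_one \<star> (\<Sum>j\<in>UNIV. B $ k $ j \<star> A $ j $ l))"
      unfolding mat_star_one_right
      by (intro dist_eq_add dist_eq_refl dist_eq_sym[OF dist_eq_star_sum_right] volterra_dist_star v)
    finally show ?thesis .
  qed
  thus ?thesis by (simp add: mat_eq_def mat_star_def one_minus_def)
qed

lemma mat_eq_one_plus_minus:
  assumes "mat_eq X C"
  shows "mat_eq (\<chi> k l. one_plus C $ k $ l + neg_one \<star> X $ k $ l) (mat_star_power A 0)"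
  using assms
  by (simp add: mat_eq_def dist_eq_def kernel_eq_def kernel_part_star one_plus_def)

lemma volterra_star_series:
  assumes "volterra_mat A"
    and "\<And>k l. summable (\<lambda>m. delta_coeff (mat_star_power A (Suc m) $ k $ l))"
  shows "volterra_mat (star_series A)"
  unfolding volterra_mat_def
  using volterra_kernel_sums[OF kernel_sums_mat_star_power[OF assms]] by blast

text \<open>From \<open>A \<star> (1 + C) = C = (1 + C) \<star> A\<close>, subtracting from \<open>1 + C\<close>.\<close>

theorem mat_star_inverse:
  assumes A: "volterra_mat A"
    and sum: "\<And>k l. summable (\<lambda>m. delta_coeff (mat_star_power A (Suc m) $ k $ l))"
  shows "mat_eq (mat_star (one_minus A) (one_plus (star_series A))) (mat_star_power A 0)"
    and "mat_eq (mat_star (one_plus (star_series A)) (one_minus A)) (mat_star_power A 0)"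
proof -
  note U = volterra_one_plus[OF volterra_star_series[OF A sum]]
  show "mat_eq (mat_star (one_minus A) (one_plus (star_series A))) (mat_star_power A 0)"
    by (rule mat_eq_trans[OF mat_star_one_minus_left[OF A U]
        mat_eq_one_plus_minus[OF mat_star_one_plus_series_left[OF A sum]]])
  show "mat_eq (mat_star (one_plus (star_series A)) (one_minus A)) (mat_star_power A 0)"
    by (rule mat_eq_trans[OF mat_star_one_minus_right[OF A U]
        mat_eq_one_plus_minus[OF mat_star_one_plus_series_right[OF A sum]]])
qed

section \<open>Invertibility of the block matrix\<close>

lemma volterra_A_Theta_t:
  assumes "f \<in> A_Theta_t"
  shows "volterra f"
proof -
  obtain ft where "analytic_on_unit_ivl ft"
    and f: "\<And>t s. t \<in> unit_ivl \<Longrightarrow> s \<in> unit_ivl \<Longrightarrow> f t s = ft t * heaviside (t - s)"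
    using assms by (auto simp: A_Theta_t_def)
  then obtain F where F: "F analytic_on (complex_of_real ` unit_ivl)"
      "\<And>t. t \<in> unit_ivl \<Longrightarrow> ft t = F (complex_of_real t)"
    by (auto simp: analytic_on_unit_ivl_def)
  have "continuous_on (complex_of_real ` unit_ivl) F"
    using F(1) by (intro holomorphic_on_imp_continuous_on analytic_imp_holomorphic)
  hence "continuous_on unit_ivl (\<lambda>t. F (complex_of_real t))"
    by (rule continuous_on_compose2) (auto intro!: continuous_intros)
  hence "continuous_on unit_ivl ft"
    by (rule continuous_on_eq) (simp add: F(2))
  hence "volterra (\<lambda>t s. ft t * heaviside (t - s))" by (rule volterra_col_heaviside)
  thus ?thesis by (rule volterra_cong) (simp add: kernel_eq_def f)
qed

lemma volterra_kernel_star_list: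
  assumes "gs \<noteq> []" "set gs \<subseteq> A_Theta_t"
  shows "volterra (kernel_star_list gs)"
  using assms
  by (induction gs rule: kernel_star_list.induct) (auto intro: volterra_A_Theta_t volterra_kernel_star)

lemma volterra_dist_D0_t:
  assumes "X \<in> D0_t"
  shows "volterra_dist X"
proof -
  obtain \<alpha> f where X: "X = StarDist \<alpha> f" by (cases X)
  with assms have ex: "\<exists>gs :: kernel list list. (\<forall>g\<in>set gs. g \<noteq> [] \<and> set g \<subseteq> A_Theta_t) \<and>
      (\<forall>t\<in>unit_ivl. \<forall>s\<in>unit_ivl. f t s = (\<Sum>g\<leftarrow>gs. kernel_star_list g t s))"
    by (simp add: D0_t_def)
  from ex obtain gs :: "kernel list list"
    where gs: "\<forall>g\<in>set gs. g \<noteq> [] \<and> set g \<subseteq> A_Theta_t"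
      and f: "\<forall>t\<in>unit_ivl. \<forall>s\<in>unit_ivl. f t s = (\<Sum>g\<leftarrow>gs. kernel_star_list g t s)"
    by (elim exE conjE)
  have "volterra (\<lambda>t s. \<Sum>g\<leftarrow>gs. kernel_star_list g t s)"
    using gs by (induction gs) (auto intro: volterra_kernel_star_list)
  hence "volterra f" by (rule volterra_cong) (simp add: kernel_eq_def f)
  thus ?thesis by (simp add: X)
qed

text \<open>The identities between matrices of distributions become identities between block matrices under the
multiplicative map \<^const>\<open>block_matrix\<close>.\<close>

theorem theorem3p2:
  fixes A C :: "star_dist^'n^'n"
  assumes "\<And>k l. A $ k $ l \<in> D0_t"
    and "\<And>k l. summable (\<lambda>m. delta_coeff (mat_star_power A (Suc m) $ k $ l))"
    and "C = star_series A"
  shows "star_series_sums A C \<and>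
    is_block_product (block_add block_one (block_matrix C))
      (block_diff block_one (block_matrix A)) block_one \<and>
    block_invertible (block_diff block_one (block_matrix A))"
proof -
  have A: "volterra_mat A"
    using assms(1) by (simp add: volterra_mat_def volterra_dist_D0_t)
  note U = volterra_one_plus[OF volterra_star_series[OF A assms(2)]] and W = volterra_one_minus[OF A]
  have UW: "is_block_product (block_add block_one (block_matrix C))
      (block_diff block_one (block_matrix A)) block_one"
    using is_block_product_mat_star[OF U W]
      block_matrix_cong[OF mat_star_inverse(2)[OF A assms(2)]]
    by (simp only: block_matrix_one_plus block_matrix_one_minus block_matrix_one assms(3))
  have WU: "is_block_product (block_diff block_one (block_matrix A))
      (block_add block_one (block_matrix C)) block_one"
    using is_block_product_mat_star[OF W U]
      block_matrix_cong[OF mat_star_inverse(1)[OF A assms(2)]]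
    by (simp only: block_matrix_one_plus block_matrix_one_minus block_matrix_one assms(3))
  show ?thesis
    using star_series_sums_star_series[OF A assms(2)] UW WU
    unfolding block_invertible_def assms(3) by blast
qed

end
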